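(* Let $\mathfrak g$ be a finite-dimensional Lie algebra over $K$. For any nontrivial action $\theta:\mathfrak g\to K[t]$ of $\mathfrak g$ on $K[t]$, the corresponding crossed product $K[t]\otimes\mathfrak g$ is isomorphic, as a Lie Rinehart algebra over $K[t]$, to an extended crossed product $K[t]\ltimes_{(\mathcal D,\delta)}L$. The data $L$, $\mathcal D$, $\delta$ are respectively specified as follows, where $[\cdot,\cdot]$ denotes the crossed product bracket, $\langle\cdots\rangle$ denotes linear span, and $K[t]\otimes(\cdots)$ in the formulas for $L$ means the $K[t]$-span. 1) If $\theta$ is of Type 1, $\theta(X)=\lambda(X)h$, then $L=K[t]\otimes\operatorname{Ker}\lambda$, $\mathcal D=[x_0,\cdot]$, $\delta=h\frac{d}{dt}$, where $x_0\in\mathfrak g$ satisfies $\lambda(x_0)=1$. 2) If $\theta$ is of Type 2, $\theta(X)=\lambda(X)(t+b)^m+\mu(X)(t+b)$ (with $m\neq1$ a nonnegative integer), then $L=K[t]\otimes\big(S\oplus\langle x_0-(t+b)^{m-1}y_0\rangle\big)$, $\mathcal D=[y_0,\cdot]$, $\delta=(t+b)\frac{d}{dt}$. Here $S\subset\mathfrak g$ is an ideal and $x_0,y_0\in\mathfrak g$ are independent vectors such that $\mathfrak g=S\oplus\langle x_0\rangle\oplus\langle y_0\rangle$, $[\mathfrak g,\mathfrak g]\subset S\oplus\langle x_0\rangle$, $[x_0,y_0]+(m-1)x_0\in S$, and $\lambda|_{S\oplus\langle y_0\rangle}=0$, $\lambda(x_0)=1$, $\mu|_{S\oplus\langle x_0\rangle}=0$,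 $\mu(y_0)=1$ (so $S=\operatorname{Ker}\lambda\cap\operatorname{Ker}\mu$). 3) If $\theta$ is of Type 3, then $L=K[t]\otimes\big(\operatorname{Rad}\mathfrak g\oplus\mathfrak m_0\oplus\langle X_2-tX_1,\;X_1-tX_0\rangle\big)$, $\mathcal D=[X_0,\cdot]$ and $\delta=\frac{d}{dt}$, where $X_0,X_1,X_2$ is the basis of $\mathfrak s\cong\mathfrak{sl}(2,K)$ with $\theta(X_0)=1$, $\theta(X_1)=t$, $\theta(X_2)=t^2$.
   Context: $K=\mathbb R$ or $\mathbb C$. For a commutative associative unital $K$-algebra $A$, a Lie Rinehart algebra over $A$ is an $A$-module $E$ which is also a $K$-Lie algebra, with an anchor $\theta:E\to\operatorname{Der}A$ that is a morphism of Lie algebras and of $A$-modules, such that $[x,ay]=a[x,y]+\theta(x)(a)y$ for $x,y\in E$, $a\in A$. An isomorphism of Lie Rinehart algebras over $A$ is an $A$-module isomorphism preserving brackets and anchors. $\operatorname{Der}K[t]$ is identified with $K[t]$ via $f\leftrightarrow f\frac{d}{dt}$, so the bracket on $K[t]$ is $[f,g]=fg'-f'g$. An action of $\mathfrak g$ on $A$ is a Lie algebra morphism $\theta:\mathfrak g\to\operatorname{Der}A$; it is nontrivial if $\theta\neq0$. The crossed product is the Lie Rinehart algebra $A\otimes_K\mathfrak g$ (write $aX$ for $a\otimes X$) with anchor the $A$-linear extension of $\theta$ and bracket $[aX,bY]=ab[X,Y]+a(\theta(X)b)Y-b(\theta(Y)a)X$. An $A$-Lie algebra $L$ is a Lie Rinehart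 algebra with zero anchor. A derivation of $L$ is a pair $(\mathcal D,\delta)$ with $\mathcal D:L\to L$ $K$-linear, $\delta\in\operatorname{Der}A$, $\mathcal D[l_1,l_2]=[\mathcal Dl_1,l_2]+[l_1,\mathcal Dl_2]$ and $\mathcal D(al)=\delta(a)l+a\mathcal Dl$. The extended crossed product $A\ltimes_{(\mathcal D,\delta)}L$ is $A\oplus L$ with anchor $\theta(a,l)=a\delta$ and bracket $[(a_1,l_1),(a_2,l_2)]=(a_1\delta(a_2)-a_2\delta(a_1),\,[l_1,l_2]_L+a_1\mathcal Dl_2-a_2\mathcal Dl_1)$. Let $\operatorname{Rad}\mathfrak g$ be the radical (maximal solvable ideal) of $\mathfrak g$ and $\mathfrak m$ a Levi subalgebra, $\mathfrak g=\operatorname{Rad}\mathfrak g\rtimes\mathfrak m$. It is known that every nontrivial action $\theta:\mathfrak g\to K[t]$ has one of the following types, according to $\operatorname{rank}\theta=\dim_K\theta(\mathfrak g)\in\{1,2,3\}$. Type 1 (rank 1): $\theta|_{\mathfrak m}=0$ and $\theta(X)=\lambda(X)h$ for all $X\in\mathfrak g$, with $0\ne h\in K[t]$, $0\neq\lambda\in\mathfrak g^*$. Type 2 (rank 2): $\theta|_{\mathfrak m}=0$ and $\theta(X)=\lambda(X)(t+b)^m+\mu(X)(t+b)$ for all $X\in\mathfrak g$, with $m\ne1$ a nonnegative integer, $b\in K$, and $\lambda,\mu\in\mathfrak g^*$ linearly independent. Type 3 (rank 3): $\mathfrak m=\mathfrak s\oplus\mathfrak m_0$ with $\mathfrak s\cong\mathfrak{sl}(2,K)$,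 $\mathfrak m_0$ a semisimple Lie subalgebra, $\operatorname{Ker}\theta=\operatorname{Rad}\mathfrak g\rtimes\mathfrak m_0$, and $\mathfrak s$ has a basis $X_0,X_1,X_2$ with $\theta(X_0)=1$, $\theta(X_1)=t$, $\theta(X_2)=t^2$ (so $[X_1,X_2]=X_2$, $[X_1,X_0]=-X_0$, $[X_2,X_0]=-2X_1$).
   Formalization: In 2), the data are as printed for m≥2; for m=0, where (t+b)^{m-1} is not in K[t] and δ=(t+b)d/dt gives the wrong anchor image, the proved data are L = K[t]-span of S and (t+b)x_0−y_0, D=[x_0,·], δ=d/dt. *)

theory Defs
  imports "HOL-Analysis.Analysis" "HOL-Computational_Algebra.Polynomial"
begin

section \<open>Lie algebras over a field\<close>

text \<open>The definitions make sense over any field \<open>K\<close>. The theorem takes \<open>K\<close> in the class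
  \<open>real_normed_field\<close>: up to isomorphism its members are exactly the real and the complex numbers
  (Gelfand-Mazur).

  Lie algebras and Lie Rinehart algebras have to be taken on subsets of a type (the algebra \<open>L\<close>
  of the theorem lives on a submodule). Addition is always that of the ambient type; the carrier
  \<open>E\<close> is a set that is closed under all operations.\<close>

definition module_on :: "('a::comm_ring_1 \<Rightarrow> 'e::ab_group_add \<Rightarrow> 'e) \<Rightarrow> 'e set \<Rightarrow> bool" where
  "module_on sm E \<longleftrightarrow>
     0 \<in> E \<and> (\<forall>x\<in>E. \<forall>y\<in>E. x + y \<in> E) \<and> (\<forall>a. \<forall>x\<in>E. sm a x \<in> E) \<and>
     (\<forall>a. \<forall>x\<in>E. \<forall>y\<in>E. sm a (x + y) = sm a x + sm a y) \<and>
     (\<forall>a b. \<forall>x\<in>E. sm (a + b) x = sm a x + sm b x) \<and>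
     (\<forall>a b. \<forall>x\<in>E. sm a (sm b x) = sm (a * b) x) \<and>
     (\<forall>x\<in>E. sm 1 x = x)"

definition lie_bracket_on ::
  "('k::field \<Rightarrow> 'e::ab_group_add \<Rightarrow> 'e) \<Rightarrow> 'e set \<Rightarrow> ('e \<Rightarrow> 'e \<Rightarrow> 'e) \<Rightarrow> bool" where
  "lie_bracket_on sc E br \<longleftrightarrow>
     (\<forall>x\<in>E. \<forall>y\<in>E. br x y \<in> E) \<and>
     (\<forall>x\<in>E. \<forall>y\<in>E. \<forall>z\<in>E. br (x + y) z = br x z + br y z \<and> br z (x + y) = br z x + br z y) \<and>
     (\<forall>c. \<forall>x\<in>E. \<forall>y\<in>E. br (sc c x) y = sc c (br x y) \<and> br x (sc c y) = sc c (br x y)) \<and>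
     (\<forall>x\<in>E. br x x = 0) \<and>
     (\<forall>x\<in>E. \<forall>y\<in>E. \<forall>z\<in>E. br x (br y z) + br y (br z x) + br z (br x y) = 0)"

locale lie_algebra = vector_space scale
  for scale :: "'k::field \<Rightarrow> 'g::ab_group_add \<Rightarrow> 'g" +
  fixes br :: "'g \<Rightarrow> 'g \<Rightarrow> 'g"
  assumes lie_bracket: "lie_bracket_on scale UNIV br"

locale fin_dim_lie_algebra = lie_algebra +
  assumes fin_dim: "\<exists>B. finite B \<and> span B = UNIV"

definition lie_subalgebra ::
  "('k::field \<Rightarrow> 'g::ab_group_add \<Rightarrow> 'g) \<Rightarrow> ('g \<Rightarrow> 'g \<Rightarrow> 'g) \<Rightarrow> 'g set \<Rightarrow> bool" where
  "lie_subalgebra sc br U \<longleftrightarrow> module.subspace sc U \<and> (\<forall>X\<in>U. \<forall>Y\<in>U. br X Y \<in> U)"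

definition lie_ideal ::
  "('k::field \<Rightarrow> 'g::ab_group_add \<Rightarrow> 'g) \<Rightarrow> ('g \<Rightarrow> 'g \<Rightarrow> 'g) \<Rightarrow> 'g set \<Rightarrow> 'g set \<Rightarrow> bool" where
  "lie_ideal sc br U I \<longleftrightarrow> I \<subseteq> U \<and> module.subspace sc I \<and> (\<forall>X\<in>U. \<forall>Y\<in>I. br X Y \<in> I)"

definition derived_algebra ::
  "('k::field \<Rightarrow> 'g::ab_group_add \<Rightarrow> 'g) \<Rightarrow> ('g \<Rightarrow> 'g \<Rightarrow> 'g) \<Rightarrow> 'g set \<Rightarrow> 'g set" where
  "derived_algebra sc br U = module.span sc {br X Y | X Y. X \<in> U \<and> Y \<in> U}"

definition solvable ::
  "('k::field \<Rightarrow> 'g::ab_group_add \<Rightarrow> 'g) \<Rightarrow> ('g \<Rightarrow> 'g \<Rightarrow> 'g) \<Rightarrow> 'g set \<Rightarrow> bool" where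
  "solvable sc br U \<longleftrightarrow> (\<exists>n. (derived_algebra sc br ^^ n) U = {0})"

text \<open>The greatest solvable ideal with respect to inclusion; it exists in finite dimension, where
  the sum of two solvable ideals is a solvable ideal.\<close>

definition lie_radical ::
  "('k::field \<Rightarrow> 'g::ab_group_add \<Rightarrow> 'g) \<Rightarrow> ('g \<Rightarrow> 'g \<Rightarrow> 'g) \<Rightarrow> 'g set" where
  "lie_radical sc br = (GREATEST R. lie_ideal sc br UNIV R \<and> solvable sc br R)"

definition semisimple ::
  "('k::field \<Rightarrow> 'g::ab_group_add \<Rightarrow> 'g) \<Rightarrow> ('g \<Rightarrow> 'g \<Rightarrow> 'g) \<Rightarrow> 'g set \<Rightarrow> bool" where
  "semisimple sc br U \<longleftrightarrow>
     lie_subalgebra sc br U \<and> (\<forall>I. lie_ideal sc br U I \<and> solvable sc br I \<longrightarrow> I = {0})"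

text \<open>Here \<open>U + V\<close> is the elementwise sum of sets.\<close>

definition direct_sum ::
  "('k::field \<Rightarrow> 'g::ab_group_add \<Rightarrow> 'g) \<Rightarrow> 'g set \<Rightarrow> 'g set \<Rightarrow> 'g set \<Rightarrow> bool" where
  "direct_sum sc W U V \<longleftrightarrow>
     module.subspace sc U \<and> module.subspace sc V \<and> U \<inter> V = {0} \<and> W = U + V"

definition semidirect_sum ::
  "('k::field \<Rightarrow> 'g::ab_group_add \<Rightarrow> 'g) \<Rightarrow> ('g \<Rightarrow> 'g \<Rightarrow> 'g) \<Rightarrow> 'g set \<Rightarrow> 'g set \<Rightarrow> 'g set \<Rightarrow> bool" where
  "semidirect_sum sc br W I U \<longleftrightarrow>
     direct_sum sc W I U \<and> lie_ideal sc br W I \<and> lie_subalgebra sc br U"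

definition lie_direct_sum ::
  "('k::field \<Rightarrow> 'g::ab_group_add \<Rightarrow> 'g) \<Rightarrow> ('g \<Rightarrow> 'g \<Rightarrow> 'g) \<Rightarrow> 'g set \<Rightarrow> 'g set \<Rightarrow> 'g set \<Rightarrow> bool" where
  "lie_direct_sum sc br W U V \<longleftrightarrow>
     direct_sum sc W U V \<and> lie_ideal sc br W U \<and> lie_ideal sc br W V"

definition levi_subalgebra ::
  "('k::field \<Rightarrow> 'g::ab_group_add \<Rightarrow> 'g) \<Rightarrow> ('g \<Rightarrow> 'g \<Rightarrow> 'g) \<Rightarrow> 'g set \<Rightarrow> bool" where
  "levi_subalgebra sc br M \<longleftrightarrow>
     semisimple sc br M \<and> semidirect_sum sc br UNIV (lie_radical sc br) M"

definition iso_sl2 ::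
  "('k::field \<Rightarrow> 'g::ab_group_add \<Rightarrow> 'g) \<Rightarrow> ('g \<Rightarrow> 'g \<Rightarrow> 'g) \<Rightarrow> 'g set \<Rightarrow> bool" where
  "iso_sl2 sc br U \<longleftrightarrow>
     lie_subalgebra sc br U \<and>
     (\<exists>f :: 'g \<Rightarrow> 'k^2^2.
        bij_betw f U {A. trace A = 0} \<and>
        (\<forall>X\<in>U. \<forall>Y\<in>U. f (X + Y) = f X + f Y) \<and>
        (\<forall>c. \<forall>X\<in>U. f (sc c X) = (\<chi> i j. c * f X $ i $ j)) \<and>
        (\<forall>X\<in>U. \<forall>Y\<in>U. f (br X Y) = f X ** f Y - f Y ** f X))"


section \<open>Lie Rinehart algebras\<close>

text \<open>The \<open>K\<close>-algebra structure of \<open>A = UNIV :: 'a set\<close> is given by \<open>sA :: 'k \<Rightarrow> 'a \<Rightarrow> 'a\<close>.\<close>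

definition k_algebra :: "('k::field \<Rightarrow> 'a::comm_ring_1 \<Rightarrow> 'a) \<Rightarrow> bool" where
  "k_algebra sA \<longleftrightarrow> vector_space sA \<and> (\<forall>c a b. sA c (a * b) = sA c a * b)"

definition derivations :: "('k::field \<Rightarrow> 'a::comm_ring_1 \<Rightarrow> 'a) \<Rightarrow> ('a \<Rightarrow> 'a) set" where
  "derivations sA =
     {d. Vector_Spaces.linear sA sA d \<and> (\<forall>a b. d (a * b) = d a * b + a * d b)}"

definition lie_action ::
  "('k::field \<Rightarrow> 'a::comm_ring_1 \<Rightarrow> 'a) \<Rightarrow> ('k \<Rightarrow> 'g::ab_group_add \<Rightarrow> 'g) \<Rightarrow> ('g \<Rightarrow> 'g \<Rightarrow> 'g) \<Rightarrow>
   ('g \<Rightarrow> 'a \<Rightarrow> 'a) \<Rightarrow> bool" where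
  "lie_action sA sc br \<rho> \<longleftrightarrow>
     (\<forall>X. \<rho> X \<in> derivations sA) \<and>
     (\<forall>X Y. \<rho> (X + Y) = (\<lambda>a. \<rho> X a + \<rho> Y a)) \<and>
     (\<forall>c X. \<rho> (sc c X) = (\<lambda>a. sA c (\<rho> X a))) \<and>
     (\<forall>X Y. \<rho> (br X Y) = (\<lambda>a. \<rho> X (\<rho> Y a) - \<rho> Y (\<rho> X a)))"

record ('a, 'e) lr_structure =
  lr_carrier :: "'e set"
  lr_smult :: "'a \<Rightarrow> 'e \<Rightarrow> 'e"
  lr_bracket :: "'e \<Rightarrow> 'e \<Rightarrow> 'e"
  lr_anchor :: "'e \<Rightarrow> 'a \<Rightarrow> 'a"

text \<open>The \<open>K\<close>-structure of an \<open>A\<close>-module is the one induced by \<open>c \<mapsto> c \<cdot> 1\<close>.\<close>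

definition lr_kscale ::
  "('k::field \<Rightarrow> 'a::comm_ring_1 \<Rightarrow> 'a) \<Rightarrow> ('a, 'e::ab_group_add) lr_structure \<Rightarrow> 'k \<Rightarrow> 'e \<Rightarrow> 'e" where
  "lr_kscale sA E c x = lr_smult E (sA c 1) x"

definition lie_rinehart ::
  "('k::field \<Rightarrow> 'a::comm_ring_1 \<Rightarrow> 'a) \<Rightarrow> ('a, 'e::ab_group_add) lr_structure \<Rightarrow> bool" where
  "lie_rinehart sA E \<longleftrightarrow>
     k_algebra sA \<and>
     module_on (lr_smult E) (lr_carrier E) \<and>
     lie_bracket_on (lr_kscale sA E) (lr_carrier E) (lr_bracket E) \<and>
     (\<forall>x\<in>lr_carrier E. lr_anchor E x \<in> derivations sA) \<and>
     (\<forall>x\<in>lr_carrier E. \<forall>y\<in>lr_carrier E.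
        lr_anchor E (x + y) = (\<lambda>f. lr_anchor E x f + lr_anchor E y f)) \<and>
     (\<forall>a. \<forall>x\<in>lr_carrier E. lr_anchor E (lr_smult E a x) = (\<lambda>f. a * lr_anchor E x f)) \<and>
     (\<forall>x\<in>lr_carrier E. \<forall>y\<in>lr_carrier E.
        lr_anchor E (lr_bracket E x y) =
          (\<lambda>f. lr_anchor E x (lr_anchor E y f) - lr_anchor E y (lr_anchor E x f))) \<and>
     (\<forall>a. \<forall>x\<in>lr_carrier E. \<forall>y\<in>lr_carrier E.
        lr_bracket E x (lr_smult E a y) =
          lr_smult E a (lr_bracket E x y) + lr_smult E (lr_anchor E x a) y)"

definition lr_isomorphic ::
  "('k::field \<Rightarrow> 'a::comm_ring_1 \<Rightarrow> 'a) \<Rightarrow> ('a, 'e::ab_group_add) lr_structure \<Rightarrow>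
   ('a, 'f::ab_group_add) lr_structure \<Rightarrow> bool" where
  "lr_isomorphic sA E F \<longleftrightarrow>
     lie_rinehart sA E \<and> lie_rinehart sA F \<and>
     (\<exists>\<phi>. bij_betw \<phi> (lr_carrier E) (lr_carrier F) \<and>
        (\<forall>x\<in>lr_carrier E. \<forall>y\<in>lr_carrier E. \<phi> (x + y) = \<phi> x + \<phi> y) \<and>
        (\<forall>a. \<forall>x\<in>lr_carrier E. \<phi> (lr_smult E a x) = lr_smult F a (\<phi> x)) \<and>
        (\<forall>x\<in>lr_carrier E. \<forall>y\<in>lr_carrier E. \<phi> (lr_bracket E x y) = lr_bracket F (\<phi> x) (\<phi> y)) \<and>
        (\<forall>x\<in>lr_carrier E. lr_anchor F (\<phi> x) = lr_anchor E x))"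

definition a_lie_algebra ::
  "('k::field \<Rightarrow> 'a::comm_ring_1 \<Rightarrow> 'a) \<Rightarrow> ('a, 'e::ab_group_add) lr_structure \<Rightarrow> bool" where
  "a_lie_algebra sA L \<longleftrightarrow>
     lie_rinehart sA L \<and> (\<forall>x\<in>lr_carrier L. lr_anchor L x = (\<lambda>_. 0))"

definition a_lie_derivation ::
  "('k::field \<Rightarrow> 'a::comm_ring_1 \<Rightarrow> 'a) \<Rightarrow> ('a, 'e::ab_group_add) lr_structure \<Rightarrow>
   ('e \<Rightarrow> 'e) \<Rightarrow> ('a \<Rightarrow> 'a) \<Rightarrow> bool" where
  "a_lie_derivation sA L D \<delta> \<longleftrightarrow>
     \<delta> \<in> derivations sA \<and>
     (\<forall>l\<in>lr_carrier L. D l \<in> lr_carrier L) \<and>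
     (\<forall>x\<in>lr_carrier L. \<forall>y\<in>lr_carrier L. D (x + y) = D x + D y) \<and>
     (\<forall>c. \<forall>x\<in>lr_carrier L. D (lr_kscale sA L c x) = lr_kscale sA L c (D x)) \<and>
     (\<forall>x\<in>lr_carrier L. \<forall>y\<in>lr_carrier L.
        D (lr_bracket L x y) = lr_bracket L (D x) y + lr_bracket L x (D y)) \<and>
     (\<forall>a. \<forall>l\<in>lr_carrier L. D (lr_smult L a l) = lr_smult L (\<delta> a) l + lr_smult L a (D l))"

definition ext_crossed_product ::
  "('a::comm_ring_1, 'e::ab_group_add) lr_structure \<Rightarrow> ('e \<Rightarrow> 'e) \<Rightarrow> ('a \<Rightarrow> 'a) \<Rightarrow>
   ('a, 'a \<times> 'e) lr_structure" where
  "ext_crossed_product L D \<delta> =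
     \<lparr> lr_carrier = UNIV \<times> lr_carrier L,
       lr_smult = (\<lambda>a (b, l). (a * b, lr_smult L a l)),
       lr_bracket = (\<lambda>(a1, l1) (a2, l2).
          (a1 * \<delta> a2 - a2 * \<delta> a1,
           lr_bracket L l1 l2 + lr_smult L a1 (D l2) - lr_smult L a2 (D l1))),
       lr_anchor = (\<lambda>(a, l) f. a * \<delta> f) \<rparr>"

text \<open>\<open>L\<close> is an \<open>A\<close>-Lie algebra, \<open>(D, \<delta>)\<close> a derivation of it, and \<open>E\<close> is isomorphic to the extended
  crossed product formed from these data.\<close>

definition iso_ext_crossed_product ::
  "('k::field \<Rightarrow> 'a::comm_ring_1 \<Rightarrow> 'a) \<Rightarrow> ('a, 'e::ab_group_add) lr_structure \<Rightarrow>
   ('a, 'f::ab_group_add) lr_structure \<Rightarrow> ('f \<Rightarrow> 'f) \<Rightarrow> ('a \<Rightarrow> 'a) \<Rightarrow> bool" where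
  "iso_ext_crossed_product sA E L D \<delta> \<longleftrightarrow>
     a_lie_algebra sA L \<and> a_lie_derivation sA L D \<delta> \<and>
     lr_isomorphic sA E (ext_crossed_product L D \<delta>)"


section \<open>The crossed product \<open>K[t] \<otimes> \<gg>\<close>\<close>

text \<open>The tensor product \<open>K[t] \<otimes> \<gg>\<close> is realised as the group \<open>\<gg>[t]\<close> of polynomials with coefficients
  in \<open>\<gg>\<close>: the coefficient of \<open>t\<^sup>i\<close> in \<open>a \<otimes> X\<close> is \<open>a\<^sub>i X\<close>. Every \<open>u\<close> is \<open>\<Sum>i. t\<^sup>i \<otimes> u\<^sub>i\<close>
  (\<open>tensor_decomp\<close>), and the universal property is \<open>tensor_universal\<close> below. The operations are
  given by their formulas on pure tensors, extended additively from the tensors \<open>t\<^sup>i \<otimes> X\<close>; the lemmas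
  \<open>tens_smult_tensor\<close>, \<open>crossed_anchor_tensor\<close> and \<open>crossed_bracket_tensor\<close> recover these formulas
  for all pure tensors.\<close>

definition tensor ::
  "('k::field \<Rightarrow> 'g::ab_group_add \<Rightarrow> 'g) \<Rightarrow> 'k poly \<Rightarrow> 'g \<Rightarrow> 'g poly" where
  "tensor sc a X = map_poly (\<lambda>c. sc c X) a"

definition tens_smult ::
  "('k::field \<Rightarrow> 'g::ab_group_add \<Rightarrow> 'g) \<Rightarrow> 'k poly \<Rightarrow> 'g poly \<Rightarrow> 'g poly" where
  "tens_smult sc a u = (\<Sum>i\<le>degree u. tensor sc (a * monom 1 i) (coeff u i))"

definition crossed_anchor ::
  "('g::ab_group_add \<Rightarrow> 'k::field poly \<Rightarrow> 'k poly) \<Rightarrow> 'g poly \<Rightarrow> 'k poly \<Rightarrow> 'k poly" where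
  "crossed_anchor \<rho> u f = (\<Sum>i\<le>degree u. monom 1 i * \<rho> (coeff u i) f)"

definition crossed_bracket ::
  "('k::field \<Rightarrow> 'g::ab_group_add \<Rightarrow> 'g) \<Rightarrow> ('g \<Rightarrow> 'g \<Rightarrow> 'g) \<Rightarrow> ('g \<Rightarrow> 'k poly \<Rightarrow> 'k poly) \<Rightarrow>
   'g poly \<Rightarrow> 'g poly \<Rightarrow> 'g poly" where
  "crossed_bracket sc br \<rho> u v =
     (let pure = (\<lambda>a X b Y. tensor sc (a * b) (br X Y) + tensor sc (a * \<rho> X b) Y
                              - tensor sc (b * \<rho> Y a) X)
      in \<Sum>i\<le>degree u. \<Sum>j\<le>degree v. pure (monom 1 i) (coeff u i) (monom 1 j) (coeff v j))"

definition crossed_product ::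
  "('k::field \<Rightarrow> 'g::ab_group_add \<Rightarrow> 'g) \<Rightarrow> ('g \<Rightarrow> 'g \<Rightarrow> 'g) \<Rightarrow> ('g \<Rightarrow> 'k poly \<Rightarrow> 'k poly) \<Rightarrow>
   ('k poly, 'g poly) lr_structure" where
  "crossed_product sc br \<rho> =
     \<lparr> lr_carrier = UNIV, lr_smult = tens_smult sc,
       lr_bracket = crossed_bracket sc br \<rho>, lr_anchor = crossed_anchor \<rho> \<rparr>"

text \<open>The \<open>A\<close>-span of a subset \<open>V\<close> of a Lie Rinehart algebra \<open>E\<close>, with the bracket of \<open>E\<close> and zero
  anchor. That the span is closed under the bracket and has zero anchor in \<open>E\<close> is not built in.\<close>

definition span_lie ::
  "('a::comm_ring_1, 'e::ab_group_add) lr_structure \<Rightarrow> 'e set \<Rightarrow> ('a, 'e) lr_structure" where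
  "span_lie E V =
     \<lparr> lr_carrier = module.span (lr_smult E) V, lr_smult = lr_smult E,
       lr_bracket = lr_bracket E, lr_anchor = (\<lambda>_ _. 0) \<rparr>"

text \<open>The identification of \<open>K[t]\<close> with \<open>Der K[t]\<close>, sending \<open>h\<close> to \<open>h d/dt\<close>.\<close>

definition vf :: "'k::field poly \<Rightarrow> 'k poly \<Rightarrow> 'k poly" where
  "vf h = (\<lambda>f. h * pderiv f)"


section \<open>The three types of actions on \<open>K[t]\<close>\<close>

definition action_rank ::
  "('g \<Rightarrow> 'k::field poly) \<Rightarrow> nat" where
  "action_rank \<theta> = vector_space.dim (smult :: 'k \<Rightarrow> _) (range \<theta>)"

definition action_type1 ::
  "('k::field \<Rightarrow> 'g::ab_group_add \<Rightarrow> 'g) \<Rightarrow> ('g \<Rightarrow> 'g \<Rightarrow> 'g) \<Rightarrow> ('g \<Rightarrow> 'k poly) \<Rightarrow>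
   'g set \<Rightarrow> ('g \<Rightarrow> 'k) \<Rightarrow> 'k poly \<Rightarrow> bool" where
  "action_type1 sc br \<theta> M lam h \<longleftrightarrow>
     levi_subalgebra sc br M \<and> action_rank \<theta> = 1 \<and>
     (\<forall>X\<in>M. \<theta> X = 0) \<and>
     h \<noteq> 0 \<and> Vector_Spaces.linear sc (*) lam \<and> lam \<noteq> (\<lambda>_. 0) \<and>
     (\<forall>X. \<theta> X = smult (lam X) h)"

definition action_type2 ::
  "('k::field \<Rightarrow> 'g::ab_group_add \<Rightarrow> 'g) \<Rightarrow> ('g \<Rightarrow> 'g \<Rightarrow> 'g) \<Rightarrow> ('g \<Rightarrow> 'k poly) \<Rightarrow>
   'g set \<Rightarrow> ('g \<Rightarrow> 'k) \<Rightarrow> ('g \<Rightarrow> 'k) \<Rightarrow> nat \<Rightarrow> 'k \<Rightarrow> bool" where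
  "action_type2 sc br \<theta> M lam mu m b \<longleftrightarrow>
     levi_subalgebra sc br M \<and> action_rank \<theta> = 2 \<and>
     (\<forall>X\<in>M. \<theta> X = 0) \<and>
     m \<noteq> 1 \<and> Vector_Spaces.linear sc (*) lam \<and> Vector_Spaces.linear sc (*) mu \<and>
     (\<forall>c d. (\<forall>X. c * lam X + d * mu X = 0) \<longrightarrow> c = 0 \<and> d = 0) \<and>
     (\<forall>X. \<theta> X = smult (lam X) ([:b, 1:] ^ m) + smult (mu X) [:b, 1:])"

definition action_type3 ::
  "('k::field \<Rightarrow> 'g::ab_group_add \<Rightarrow> 'g) \<Rightarrow> ('g \<Rightarrow> 'g \<Rightarrow> 'g) \<Rightarrow> ('g \<Rightarrow> 'k poly) \<Rightarrow>
   'g set \<Rightarrow> 'g set \<Rightarrow> 'g set \<Rightarrow> 'g \<Rightarrow> 'g \<Rightarrow> 'g \<Rightarrow> bool" where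
  "action_type3 sc br \<theta> M \<ss> M0 X0 X1 X2 \<longleftrightarrow>
     levi_subalgebra sc br M \<and> action_rank \<theta> = 3 \<and>
     lie_direct_sum sc br M \<ss> M0 \<and> iso_sl2 sc br \<ss> \<and> semisimple sc br M0 \<and>
     semidirect_sum sc br {X. \<theta> X = 0} (lie_radical sc br) M0 \<and>
     distinct [X0, X1, X2] \<and> \<not> module.dependent sc {X0, X1, X2} \<and>
     module.span sc {X0, X1, X2} = \<ss> \<and>
     \<theta> X0 = 1 \<and> \<theta> X1 = [:0, 1:] \<and> \<theta> X2 = [:0, 1:] ^ 2"

text \<open>The auxiliary data \<open>S, x0, y0\<close> attached to an action of Type 2. If \<open>m \<ge> 2\<close>, they give
  the anchor-free element \<open>x0 - (t + b)\<^sup>m\<^sup>-\<^sup>1 y0\<close>, and \<open>y0\<close> has anchor \<open>(t + b) d/dt\<close>.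
  If \<open>m = 0\<close>, the exponent is negative, and the image of the anchor of \<open>K[t] \<otimes> \<gg>\<close> is all of
  \<open>K[t] d/dt\<close>, so that no extended crossed product with \<open>\<delta> = (t + b) d/dt\<close> is isomorphic to
  \<open>K[t] \<otimes> \<gg>\<close>. In this case the roles of \<open>x0\<close> and \<open>y0\<close> are exchanged: \<open>(t + b) x0 - y0\<close> is
  anchor-free, and \<open>x0\<close> has anchor \<open>d/dt\<close>.\<close>

definition adapted ::
  "('k::field \<Rightarrow> 'g::ab_group_add \<Rightarrow> 'g) \<Rightarrow> ('g \<Rightarrow> 'g \<Rightarrow> 'g) \<Rightarrow>
   ('g \<Rightarrow> 'k) \<Rightarrow> ('g \<Rightarrow> 'k) \<Rightarrow> nat \<Rightarrow> 'g set \<Rightarrow> 'g \<Rightarrow> 'g \<Rightarrow> bool" where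
  "adapted sc br lam mu m S x0 y0 \<longleftrightarrow>
     (let Sx = S + module.span sc {x0}; Sy = S + module.span sc {y0} in
      lie_ideal sc br UNIV S \<and>
      x0 \<noteq> y0 \<and> \<not> module.dependent sc {x0, y0} \<and>
      direct_sum sc Sx S (module.span sc {x0}) \<and>
      direct_sum sc UNIV Sx (module.span sc {y0}) \<and>
      derived_algebra sc br UNIV \<subseteq> Sx \<and>
      br x0 y0 + sc (of_nat m - 1) x0 \<in> S \<and>
      (\<forall>X\<in>Sy. lam X = 0) \<and> lam x0 = 1 \<and>
      (\<forall>X\<in>Sx. mu X = 0) \<and> mu y0 = 1)"


section \<open>Adequacy of the model of the crossed product\<close>

context vector_space
begin

lemma coeff_tensor [simp]: "coeff (tensor scale a X) i = scale (coeff a i) X"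
  by (simp add: tensor_def coeff_map_poly)

lemma tensor_add_left: "tensor scale (a + b) X = tensor scale a X + tensor scale b X"
  by (rule poly_eqI) (simp add: scale_left_distrib)

lemma tensor_add_right: "tensor scale a (X + Y) = tensor scale a X + tensor scale a Y"
  by (rule poly_eqI) (simp add: scale_right_distrib)

lemma tensor_smult: "tensor scale (smult c a) X = tensor scale a (scale c X)"
  by (rule poly_eqI) (simp add: mult.commute)

lemma tensor_zero [simp]: "tensor scale 0 X = 0" "tensor scale a 0 = 0"
  by (rule poly_eqI, simp)+

lemma tensor_decomp: "u = (\<Sum>i\<le>degree u. tensor scale (monom 1 i) (coeff u i))"
proof (rule poly_eqI)
  fix n
  have "(\<Sum>i\<le>degree u. scale (if i = n then 1 else 0) (coeff u i)) =
        (\<Sum>i\<le>degree u. if i = n then coeff u i else 0)"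
    by (intro sum.cong) auto
  also have "\<dots> = coeff u n"
    by (auto simp: coeff_eq_0)
  finally show "coeff u n = coeff (\<Sum>i\<le>degree u. tensor scale (monom 1 i) (coeff u i)) n"
    by (simp add: coeff_sum)
qed

text \<open>Additive extension from \<open>t\<^sup>i \<otimes> X\<close> reproduces a balanced biadditive map on all pure tensors.\<close>

lemma tensor_extension:
  fixes f :: "'a poly \<Rightarrow> 'b \<Rightarrow> 'w::ab_group_add"
  assumes add1: "\<And>a b X. f (a + b) X = f a X + f b X"
    and add2: "\<And>a X Y. f a (X + Y) = f a X + f a Y"
    and bal: "\<And>c a X. f (smult c a) X = f a (scale c X)"
  shows "(\<Sum>i\<le>degree (tensor scale a X). f (monom 1 i) (coeff (tensor scale a X) i)) = f a X"
proof -
  have z1: "f 0 Y = 0" for Y using add1[of 0 0 Y] by simp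
  have z2: "f p 0 = 0" for p using add2[of p 0 0] by simp
  have fsum: "f (sum g I) Y = (\<Sum>i\<in>I. f (g i) Y)" for g I Y
    by (induction I rule: infinite_finite_induct) (auto simp: z1 add1)
  let ?u = "tensor scale a X"
  have "degree ?u \<le> degree a"
    by (rule degree_le) (simp add: coeff_eq_0)
  then have "(\<Sum>i\<le>degree ?u. f (monom 1 i) (coeff ?u i)) = (\<Sum>i\<le>degree a. f (monom 1 i) (coeff ?u i))"
    by (intro sum.mono_neutral_left) (auto simp: coeff_eq_0 z2 simp del: coeff_tensor)
  also have "\<dots> = (\<Sum>i\<le>degree a. f (monom (coeff a i) i) X)"
    by (intro sum.cong) (simp_all flip: bal add: smult_monom)
  also have "\<dots> = f (\<Sum>i\<le>degree a. monom (coeff a i) i) X"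
    by (simp add: fsum)
  finally show ?thesis
    by (simp only: poly_as_sum_of_monoms)
qed

lemma additive_extension:
  fixes f :: "'a poly \<Rightarrow> 'b \<Rightarrow> 'w::ab_group_add"
  assumes add2: "\<And>a X Y. f a (X + Y) = f a X + f a Y"
  shows "(\<Sum>i\<le>degree (u + v). f (monom 1 i) (coeff (u + v) i)) =
         (\<Sum>i\<le>degree u. f (monom 1 i) (coeff u i)) + (\<Sum>i\<le>degree v. f (monom 1 i) (coeff v i))"
proof -
  have z2: "f p 0 = 0" for p using add2[of p 0 0] by simp
  define N where "N = max (degree u) (degree v)"
  have *: "(\<Sum>i\<le>degree w. f (monom 1 i) (coeff w i)) = (\<Sum>i\<le>N. f (monom 1 i) (coeff w i))"
    if "degree w \<le> N" for w
    using that by (intro sum.mono_neutral_left) (auto simp: coeff_eq_0 z2)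
  have N: "degree (u + v) \<le> N" "degree u \<le> N" "degree v \<le> N"
    by (auto simp: N_def degree_add_le_max)
  show ?thesis
    unfolding *[OF N(1)] *[OF N(2)] *[OF N(3)] by (simp add: add2 sum.distrib)
qed

lemma tensor_universal:
  fixes f :: "'a poly \<Rightarrow> 'b \<Rightarrow> 'w::ab_group_add"
  assumes add1: "\<And>a b X. f (a + b) X = f a X + f b X"
    and add2: "\<And>a X Y. f a (X + Y) = f a X + f a Y"
    and bal: "\<And>c a X. f (smult c a) X = f a (scale c X)"
  shows "\<exists>!F. (\<forall>u v. F (u + v) = F u + F v) \<and> (\<forall>a X. F (tensor scale a X) = f a X)"
proof (rule ex1I)
  let ?F = "\<lambda>u. \<Sum>i\<le>degree u. f (monom 1 i) (coeff u i)"
  show "(\<forall>u v. ?F (u + v) = ?F u + ?F v) \<and> (\<forall>a X. ?F (tensor scale a X) = f a X)"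
    using additive_extension[of f, OF add2] tensor_extension[of f, OF add1 add2 bal] by blast
next
  fix F assume F: "(\<forall>u v. F (u + v) = F u + F v) \<and> (\<forall>a X. F (tensor scale a X) = f a X)"
  have F0: "F 0 = 0" using F by (metis add_cancel_right_right)
  have Fsum: "F (sum g I) = (\<Sum>i\<in>I. F (g i))" for I and g :: "nat \<Rightarrow> 'b poly"
    by (induction I rule: infinite_finite_induct) (auto simp: F0 F)
  show "F = (\<lambda>u. \<Sum>i\<le>degree u. f (monom 1 i) (coeff u i))"
  proof
    fix u
    have "F u = F (\<Sum>i\<le>degree u. tensor scale (monom 1 i) (coeff u i))"
      using tensor_decomp[of u] by simp
    also have "\<dots> = (\<Sum>i\<le>degree u. f (monom 1 i) (coeff u i))"
      by (simp only: Fsum F)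
    finally show "F u = (\<Sum>i\<le>degree u. f (monom 1 i) (coeff u i))" .
  qed
qed

lemma tens_smult_add: "tens_smult scale a (u + v) = tens_smult scale a u + tens_smult scale a v"
  using additive_extension[of "\<lambda>b. tensor scale (a * b)" u v]
  by (simp add: tens_smult_def tensor_add_right)

lemma tens_smult_tensor: "tens_smult scale a (tensor scale b X) = tensor scale (a * b) X"
  using tensor_extension[of "\<lambda>b. tensor scale (a * b)" b X]
  by (simp add: tens_smult_def tensor_add_right distrib_left tensor_add_left flip: tensor_smult)

end

context lie_algebra
begin

lemma crossed_anchor_add:
  assumes "lie_action smult scale br \<rho>"
  shows "crossed_anchor \<rho> (u + v) f = crossed_anchor \<rho> u f + crossed_anchor \<rho> v f"
  using additive_extension[of "\<lambda>b X. b * \<rho> X f" u v] assms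
  by (simp add: crossed_anchor_def lie_action_def distrib_left)

lemma crossed_anchor_tensor:
  assumes "lie_action smult scale br \<rho>"
  shows "crossed_anchor \<rho> (tensor scale a X) f = a * \<rho> X f"
  using tensor_extension[of "\<lambda>b X. b * \<rho> X f" a X] assms
  by (simp add: crossed_anchor_def lie_action_def distrib_left distrib_right)

definition pure_bracket ::
  "('g \<Rightarrow> 'k poly \<Rightarrow> 'k poly) \<Rightarrow> 'k poly \<Rightarrow> 'g \<Rightarrow> 'k poly \<Rightarrow> 'g \<Rightarrow> 'g poly" where
  "pure_bracket \<rho> a X b Y =
     tensor scale (a * b) (br X Y) + tensor scale (a * \<rho> X b) Y - tensor scale (b * \<rho> Y a) X"

lemma crossed_bracket_altdef:
  "crossed_bracket scale br \<rho> u v =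
    (\<Sum>i\<le>degree u. \<Sum>j\<le>degree v. pure_bracket \<rho> (monom 1 i) (coeff u i) (monom 1 j) (coeff v j))"
  by (simp add: crossed_bracket_def pure_bracket_def)

lemma pure_bracket_bilinear:
  assumes "lie_action smult scale br \<rho>"
  shows "pure_bracket \<rho> (a + a') X b Y = pure_bracket \<rho> a X b Y + pure_bracket \<rho> a' X b Y"
    and "pure_bracket \<rho> a (X + X') b Y = pure_bracket \<rho> a X b Y + pure_bracket \<rho> a X' b Y"
    and "pure_bracket \<rho> (smult c a) X b Y = pure_bracket \<rho> a (scale c X) b Y"
    and "pure_bracket \<rho> a X (b + b') Y = pure_bracket \<rho> a X b Y + pure_bracket \<rho> a X b' Y"
    and "pure_bracket \<rho> a X b (Y + Y') = pure_bracket \<rho> a X b Y + pure_bracket \<rho> a X b Y'"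
    and "pure_bracket \<rho> a X (smult c b) Y = pure_bracket \<rho> a X b (scale c Y)"
proof -
  have lin: "\<rho> Z (p + q) = \<rho> Z p + \<rho> Z q" "\<rho> Z (smult d p) = smult d (\<rho> Z p)" for Z p q d
    using assms module_hom.add[of smult smult "\<rho> Z"] module_hom.scale[of smult smult "\<rho> Z"]
    by (auto simp: lie_action_def derivations_def linear_iff_module_hom)
  have act: "\<rho> (Z + W) p = \<rho> Z p + \<rho> W p" "\<rho> (scale d Z) p = smult d (\<rho> Z p)" for Z W d p
    using assms by (auto simp: lie_action_def)
  have brr: "br (Z + W) V = br Z V + br W V" "br V (Z + W) = br V Z + br V W"
    "br (scale d Z) W = scale d (br Z W)" "br Z (scale d W) = scale d (br Z W)" for Z W V d
    using lie_bracket by (auto simp: lie_bracket_on_def)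
  show "pure_bracket \<rho> (a + a') X b Y = pure_bracket \<rho> a X b Y + pure_bracket \<rho> a' X b Y"
    "pure_bracket \<rho> a (X + X') b Y = pure_bracket \<rho> a X b Y + pure_bracket \<rho> a X' b Y"
    "pure_bracket \<rho> (smult c a) X b Y = pure_bracket \<rho> a (scale c X) b Y"
    "pure_bracket \<rho> a X (b + b') Y = pure_bracket \<rho> a X b Y + pure_bracket \<rho> a X b' Y"
    "pure_bracket \<rho> a X b (Y + Y') = pure_bracket \<rho> a X b Y + pure_bracket \<rho> a X b Y'"
    "pure_bracket \<rho> a X (smult c b) Y = pure_bracket \<rho> a X b (scale c Y)"
    by (simp_all add: pure_bracket_def lin act brr distrib_left distrib_right
        tensor_add_left tensor_add_right tensor_smult)
qed

lemma crossed_bracket_add: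
  assumes "lie_action smult scale br \<rho>"
  shows "crossed_bracket scale br \<rho> (u + u') v =
         crossed_bracket scale br \<rho> u v + crossed_bracket scale br \<rho> u' v"
    and "crossed_bracket scale br \<rho> u (v + v') =
         crossed_bracket scale br \<rho> u v + crossed_bracket scale br \<rho> u v'"
proof -
  note pb = pure_bracket_bilinear[OF assms]
  show "crossed_bracket scale br \<rho> (u + u') v =
         crossed_bracket scale br \<rho> u v + crossed_bracket scale br \<rho> u' v"
    unfolding crossed_bracket_altdef
    by (rule additive_extension) (simp add: pb sum.distrib)
  show "crossed_bracket scale br \<rho> u (v + v') =
         crossed_bracket scale br \<rho> u v + crossed_bracket scale br \<rho> u v'"
    unfolding crossed_bracket_altdef sum.distrib[symmetric]
    by (intro sum.cong refl additive_extension) (simp add: pb)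
qed

lemma crossed_bracket_tensor:
  assumes "lie_action smult scale br \<rho>"
  shows "crossed_bracket scale br \<rho> (tensor scale a X) (tensor scale b Y) =
     tensor scale (a * b) (br X Y) + tensor scale (a * \<rho> X b) Y - tensor scale (b * \<rho> Y a) X"
proof -
  note pb = pure_bracket_bilinear[OF assms]
  have "crossed_bracket scale br \<rho> (tensor scale a X) v =
        (\<Sum>j\<le>degree v. pure_bracket \<rho> a X (monom 1 j) (coeff v j))" for v
    unfolding crossed_bracket_altdef
    by (rule tensor_extension) (simp_all add: pb sum.distrib)
  also have "(\<Sum>j\<le>degree (tensor scale b Y).
      pure_bracket \<rho> a X (monom 1 j) (coeff (tensor scale b Y) j)) = pure_bracket \<rho> a X b Y"
    by (rule tensor_extension) (simp_all add: pb)
  finally show ?thesis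
    by (simp add: pure_bracket_def)
qed

end

end

theory Submission
  imports Defs
begin

text \<open>The image of the anchor of \<open>E = K[t] \<otimes> \<gg>\<close> is a nonzero ideal \<open>(p)\<close> of \<open>K[t]\<close>, hence a free module of
  rank one. An element \<open>e\<close> with anchor \<open>p d/dt\<close> therefore splits off: \<open>E = K[t] e \<oplus> L\<close> with \<open>L\<close> the
  kernel of the anchor, and \<open>(a, l) \<mapsto> a e + l\<close> carries the extended crossed product formed from
  \<open>L\<close>, \<open>[e, \<cdot>]\<close> and \<open>p d/dt\<close> onto \<open>E\<close>. For the three types \<open>e\<close> is explicit, and anchor-free elements span
  the kernel as soon as they generate \<open>E\<close> together with \<open>e\<close>.\<close>

section \<open>Lie Rinehart algebras with a split anchor\<close>

lemma derivationsD:
  assumes "d \<in> derivations sA"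
  shows "d (a + b) = d a + d b" "d (a - b) = d a - d b" "d 0 = 0" "d (- a) = - d a"
    "d (sA c a) = sA c (d a)" "d (a * b) = d a * b + a * d b" "d 1 = 0" "d (sA c 1) = 0"
proof -
  have lin: "Vector_Spaces.linear sA sA d" and prod: "d (a * b) = d a * b + a * d b" for a b
    using assms by (auto simp: derivations_def)
  interpret d: Vector_Spaces.linear sA sA d by (rule lin)
  show "d (a + b) = d a + d b" "d (a - b) = d a - d b" "d 0 = 0" "d (- a) = - d a"
    "d (sA c a) = sA c (d a)" "d (a * b) = d a * b + a * d b"
    by (simp_all add: d.add d.diff d.zero d.neg d.scale prod)
  show one: "d 1 = 0" using prod[of 1 1] by simp
  show "d (sA c 1) = 0" by (simp add: d.scale one)
qed

lemma lie_bracket_onD: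
  assumes "lie_bracket_on sc E br" "x \<in> E"
  shows "y \<in> E \<Longrightarrow> br x y \<in> E"
    "y \<in> E \<Longrightarrow> z \<in> E \<Longrightarrow> br (x + y) z = br x z + br y z"
    "y \<in> E \<Longrightarrow> z \<in> E \<Longrightarrow> br z (x + y) = br z x + br z y"
    "y \<in> E \<Longrightarrow> br (sc c x) y = sc c (br x y)"
    "y \<in> E \<Longrightarrow> br x (sc c y) = sc c (br x y)"
    "br x x = 0"
    "y \<in> E \<Longrightarrow> z \<in> E \<Longrightarrow> br x (br y z) + br y (br z x) + br z (br x y) = 0"
  using assms unfolding lie_bracket_on_def by auto

text \<open>Polarization of \<open>br z z = 0\<close> at \<open>z = x + y\<close>. Closure under
  addition is not part of \<open>lie_bracket_on\<close>, so membership of \<open>x + y\<close> is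
  asked for separately.\<close>

lemma lie_bracket_on_skew:
  assumes "lie_bracket_on sc E br" "x \<in> E" "y \<in> E" "x + y \<in> E"
  shows "br x y = - br y x"
proof -
  note B = lie_bracket_onD[OF assms(1)]
  have "br (x + y) (x + y) = 0" using assms(4) by (rule B(6))
  then show ?thesis
    using assms by (simp add: B(2,3) del: B(6)) (simp add: B(6) eq_neg_iff_add_eq_0 add.commute)
qed

lemma module_onD:
  assumes "module_on sm E"
  shows "0 \<in> E" "x \<in> E \<Longrightarrow> y \<in> E \<Longrightarrow> x + y \<in> E" "x \<in> E \<Longrightarrow> sm a x \<in> E"
    "x \<in> E \<Longrightarrow> y \<in> E \<Longrightarrow> sm a (x + y) = sm a x + sm a y"
    "x \<in> E \<Longrightarrow> sm (a + b) x = sm a x + sm b x"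
    "x \<in> E \<Longrightarrow> sm a (sm b x) = sm (a * b) x" "x \<in> E \<Longrightarrow> sm 1 x = x"
  using assms unfolding module_on_def by auto

lemma lie_rinehartD:
  assumes "lie_rinehart sA E"
  shows "k_algebra sA" "module_on (lr_smult E) (lr_carrier E)"
    "lie_bracket_on (lr_kscale sA E) (lr_carrier E) (lr_bracket E)"
    "x \<in> lr_carrier E \<Longrightarrow> lr_anchor E x \<in> derivations sA"
    "x \<in> lr_carrier E \<Longrightarrow> y \<in> lr_carrier E \<Longrightarrow> lr_anchor E (x + y) f = lr_anchor E x f + lr_anchor E y f"
    "x \<in> lr_carrier E \<Longrightarrow> lr_anchor E (lr_smult E a x) f = a * lr_anchor E x f"
    "x \<in> lr_carrier E \<Longrightarrow> y \<in> lr_carrier E \<Longrightarrow>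
      lr_anchor E (lr_bracket E x y) f = lr_anchor E x (lr_anchor E y f) - lr_anchor E y (lr_anchor E x f)"
    "x \<in> lr_carrier E \<Longrightarrow> y \<in> lr_carrier E \<Longrightarrow>
      lr_bracket E x (lr_smult E a y) = lr_smult E a (lr_bracket E x y) + lr_smult E (lr_anchor E x a) y"
  using assms unfolding lie_rinehart_def by auto

text \<open>Apart from closure, the axioms are equations in \<open>F\<close>, which can be checked
  after the injective \<open>\<psi>\<close>, or statements on anchors, which agree. This spares a
  direct verification for the submodule \<open>L\<close> (with \<open>\<psi> = id\<close>) and for
  the pairs \<open>(a, l)\<close> of the extended crossed product.\<close>

lemma lie_rinehart_pullback:
  assumes E: "lie_rinehart sA E"
    and zero: "0 \<in> lr_carrier F"
    and closed: "\<And>x y. x \<in> lr_carrier F \<Longrightarrow> y \<in> lr_carrier F \<Longrightarrow> x + y \<in> lr_carrier F"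
      "\<And>a x. x \<in> lr_carrier F \<Longrightarrow> lr_smult F a x \<in> lr_carrier F"
      "\<And>x y. x \<in> lr_carrier F \<Longrightarrow> y \<in> lr_carrier F \<Longrightarrow> lr_bracket F x y \<in> lr_carrier F"
    and inj: "inj_on \<psi> (lr_carrier F)"
    and into: "\<And>x. x \<in> lr_carrier F \<Longrightarrow> \<psi> x \<in> lr_carrier E"
    and hom: "\<And>x y. x \<in> lr_carrier F \<Longrightarrow> y \<in> lr_carrier F \<Longrightarrow> \<psi> (x + y) = \<psi> x + \<psi> y"
      "\<And>a x. x \<in> lr_carrier F \<Longrightarrow> \<psi> (lr_smult F a x) = lr_smult E a (\<psi> x)"
      "\<And>x y. x \<in> lr_carrier F \<Longrightarrow> y \<in> lr_carrier F \<Longrightarrow>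
         \<psi> (lr_bracket F x y) = lr_bracket E (\<psi> x) (\<psi> y)"
    and anchor: "\<And>x. x \<in> lr_carrier F \<Longrightarrow> lr_anchor F x = lr_anchor E (\<psi> x)"
  shows "lie_rinehart sA F"
proof -
  note D = lie_rinehartD[OF E]
  note M = module_onD[OF D(2)] and B = lie_bracket_onD[OF D(3)]
  note simps = zero closed into hom
  have psi0: "\<psi> 0 = 0" using hom(1)[OF zero zero] by simp
  have eq: "x = y" if "\<psi> x = \<psi> y" "x \<in> lr_carrier F" "y \<in> lr_carrier F" for x y
    using inj that by (auto dest: inj_onD)
  have "module_on (lr_smult F) (lr_carrier F)"
    unfolding module_on_def
    by (intro conjI ballI allI) (auto intro!: eq simp: simps M)
  moreover have "lie_bracket_on (lr_kscale sA F) (lr_carrier F) (lr_bracket F)"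
    unfolding lie_bracket_on_def lr_kscale_def
    by (intro conjI ballI allI) (auto intro!: eq simp: simps psi0 B B(4,5)[unfolded lr_kscale_def])
  ultimately show ?thesis
    unfolding lie_rinehart_def
    by (intro conjI ballI allI) (auto intro!: eq simp: simps D anchor)
qed

text \<open>The explicit map \<open>(a, l) \<mapsto> a e + l\<close> goes from \<open>F\<close> to
  \<open>E\<close>, against the direction in \<open>lr_isomorphic\<close>. Its inverse respects the
  operations because both sides of each identity have the same image under
  \<open>\<psi>\<close>.\<close>

lemma lr_isomorphicI:
  assumes "lie_rinehart sA E" "lie_rinehart sA F"
    and bij: "bij_betw \<psi> (lr_carrier F) (lr_carrier E)"
    and hom: "\<And>x y. x \<in> lr_carrier F \<Longrightarrow> y \<in> lr_carrier F \<Longrightarrow> \<psi> (x + y) = \<psi> x + \<psi> y"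
      "\<And>a x. x \<in> lr_carrier F \<Longrightarrow> \<psi> (lr_smult F a x) = lr_smult E a (\<psi> x)"
      "\<And>x y. x \<in> lr_carrier F \<Longrightarrow> y \<in> lr_carrier F \<Longrightarrow>
         \<psi> (lr_bracket F x y) = lr_bracket E (\<psi> x) (\<psi> y)"
    and anchor: "\<And>x. x \<in> lr_carrier F \<Longrightarrow> lr_anchor F x = lr_anchor E (\<psi> x)"
  shows "lr_isomorphic sA E F"
proof -
  let ?\<phi> = "inv_into (lr_carrier F) \<psi>"
  have bij': "bij_betw ?\<phi> (lr_carrier E) (lr_carrier F)"
    using bij by (rule bij_betw_inv_into)
  have phi: "?\<phi> x \<in> lr_carrier F" "\<psi> (?\<phi> x) = x" if "x \<in> lr_carrier E" for x
    using bij bij' that by (auto simp: bij_betw_def f_inv_into_f)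
  have phiI: "?\<phi> (\<psi> z) = z" if "z \<in> lr_carrier F" for z
    using bij that by (rule bij_betw_inv_into_left)
  note D = lie_rinehartD[OF assms(2)]
  note closed = module_onD[OF D(2)] lie_bracket_onD(1)[OF D(3)]
  have "?\<phi> (x + y) = ?\<phi> x + ?\<phi> y" "?\<phi> (lr_smult E a x) = lr_smult F a (?\<phi> x)"
    "?\<phi> (lr_bracket E x y) = lr_bracket F (?\<phi> x) (?\<phi> y)" "lr_anchor F (?\<phi> x) = lr_anchor E x"
    if "x \<in> lr_carrier E" "y \<in> lr_carrier E" for x y a
    using phiI[of "?\<phi> x + ?\<phi> y"] phiI[of "lr_smult F a (?\<phi> x)"] closed(3)[of "?\<phi> x" a]
      phiI[of "lr_bracket F (?\<phi> x) (?\<phi> y)"]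
    by (simp_all add: hom anchor phi that closed)
  with bij' assms(1,2) show ?thesis
    unfolding lr_isomorphic_def by blast
qed

text \<open>By \<open>gen\<close>, every element is \<open>a e + l\<close> with \<open>l\<close> in
  the span of \<open>V\<close>. Its anchor is \<open>a\<close> times that of \<open>e\<close>, so
  hypothesis \<open>e\<close> makes \<open>a\<close> unique. Hence the span is the whole kernel of
  the anchor, and its closure under the bracket need not be checked on generators.\<close>

lemma iso_ext_crossed_product_split:
  assumes E: "lie_rinehart sA E" and UNIV: "lr_carrier E = UNIV"
    and V: "\<And>v. v \<in> V \<Longrightarrow> lr_anchor E v = (\<lambda>_. 0)"
    and e: "\<And>a. (\<And>f. a * lr_anchor E e f = 0) \<Longrightarrow> a = 0"
    and gen: "module.span (lr_smult E) (insert e V) = UNIV"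
  shows "iso_ext_crossed_product sA E (span_lie E V) (lr_bracket E e) (lr_anchor E e)"
proof -
  note D = lie_rinehartD[OF E, unfolded UNIV, simplified]
  note M = module_onD[OF D(2), simplified] and B = lie_bracket_onD[OF D(3), simplified]
  interpret M: module "lr_smult E"
    by unfold_locales (simp_all add: M)
  let ?L = "M.span V" and ?\<delta> = "lr_anchor E e"
  let ?F = "ext_crossed_product (span_lie E V) (lr_bracket E e) ?\<delta>"
  note anc = derivationsD[OF D(4)]
  have anc0: "lr_anchor E 0 f = 0" for f
    using D(5)[of 0 0 f] by simp
  have split: "\<exists>a. u - lr_smult E a e \<in> ?L" for u
    using gen M.span_breakdown_eq[of u e V] by auto
  have ker: "lr_anchor E u = (\<lambda>_. 0)" if "u \<in> ?L" for u
    using that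
    by (induction rule: M.span_induct_alt) (simp_all add: anc0 D V fun_eq_iff)
  \<comment> \<open>Converse of \<open>ker\<close>: subtracting \<open>a e\<close> brings
    \<open>u\<close> into the span, and comparing anchors gives \<open>a = 0\<close>.\<close>
  have LI: "u \<in> ?L" if u: "\<And>f. lr_anchor E u f = 0" for u
  proof -
    obtain a where a: "u - lr_smult E a e \<in> ?L" using split by blast
    have "lr_anchor E u f = a * lr_anchor E e f" for f
      using D(5)[of "u - lr_smult E a e" "lr_smult E a e" f] ker[OF a] by (simp add: D)
    with u have "a = 0" by (metis e)
    with a show ?thesis by simp
  qed
  \<comment> \<open>The anchor of \<open>[u, l]\<close> is a commutator with the zero derivation. As
    \<open>u\<close> is arbitrary, the kernel is an ideal, in particular stable under
    \<open>[e, \<cdot>]\<close>.\<close>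
  have Lbr: "lr_bracket E u l \<in> ?L" if "l \<in> ?L" for u l
    using ker[OF that] by (intro LI) (simp add: D anc)
  note skew = lie_bracket_on_skew[OF D(3), simplified]
  have brR: "lr_bracket E x (lr_smult E a y) = lr_smult E a (lr_bracket E x y) + lr_smult E (lr_anchor E x a) y"
    for a x y by (simp add: D)
  have brL: "lr_bracket E (lr_smult E a x) y = lr_smult E a (lr_bracket E x y) - lr_smult E (lr_anchor E y a) x"
    for a x y
    using skew[of "lr_smult E a x" y] skew[of y x] by (simp add: brR)
  have L: "lie_rinehart sA (span_lie E V)"
    by (rule lie_rinehart_pullback[OF E, where \<psi> = id])
      (simp_all add: span_lie_def UNIV M.span_zero M.span_add M.span_scale Lbr ker)
  \<comment> \<open>The Jacobi identity, rearranged as the derivation rule for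
    \<open>[e, \<cdot>]\<close>. A minus sign is pulled out of the second argument by
    additivity.\<close>
  have jac: "lr_bracket E e (lr_bracket E x y) =
      lr_bracket E (lr_bracket E e x) y + lr_bracket E x (lr_bracket E e y)" for x y
  proof -
    have "lr_bracket E x (lr_bracket E y e) = lr_bracket E x (- lr_bracket E e y)"
      by (simp only: skew[of y e])
    also have "\<dots> = - lr_bracket E x (lr_bracket E e y)"
      using B(3)[where x = "lr_bracket E e y" and y = "- lr_bracket E e y" and z = x]
        B(3)[where x = 0 and y = 0 and z = x]
      by (simp add: minus_unique)
    finally have "lr_bracket E e (lr_bracket E x y) - lr_bracket E x (lr_bracket E e y)
        - lr_bracket E (lr_bracket E e x) y = 0"
      using B(7)[of e x y] skew[of y "lr_bracket E e x"] by simp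
    then show ?thesis
      by (simp add: algebra_simps)
  qed
  \<comment> \<open>Since \<open>\<delta>\<close> kills the constants \<open>c \<cdot> 1\<close>,
    the Leibniz rule also yields linearity of \<open>[e, \<cdot>]\<close> over
    \<open>K\<close>.\<close>
  have der: "a_lie_derivation sA (span_lie E V) (lr_bracket E e) ?\<delta>"
    unfolding a_lie_derivation_def
    by (auto simp: span_lie_def Lbr D(4) B(3) jac D(8) lr_kscale_def anc(3,8) algebra_simps)
  let ?\<psi> = "\<lambda>(a, l). lr_smult E a e + l"
  have inj: "inj_on ?\<psi> (lr_carrier ?F)"
  proof (rule inj_onI, clarify)
    fix a l b k
    assume "(a, l) \<in> lr_carrier ?F" "(b, k) \<in> lr_carrier ?F"
      and eq: "lr_smult E a e + l = lr_smult E b e + k"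
    then have lk: "l \<in> ?L" "k \<in> ?L"
      by (auto simp: ext_crossed_product_def span_lie_def)
    \<comment> \<open>The summands \<open>l\<close> and \<open>k\<close> contribute nothing to the
      anchors, which are therefore \<open>a \<delta>\<close> and \<open>b \<delta>\<close>.\<close>
    have "lr_anchor E (lr_smult E a e + l) f = lr_anchor E (lr_smult E b e + k) f" for f
      by (simp add: eq)
    then have "a = b"
      using e[of "a - b"] by (simp add: D ker lk algebra_simps)
    with eq show "a = b \<and> l = k" by simp
  qed
  have surj: "?\<psi> ` lr_carrier ?F = UNIV"
  proof (rule UNIV_eq_I[symmetric])
    fix u
    obtain a where "u - lr_smult E a e \<in> ?L" using split by blast
    then show "u \<in> ?\<psi> ` lr_carrier ?F"
      by (intro image_eqI[where x = "(a, u - lr_smult E a e)"])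
        (auto simp: ext_crossed_product_def span_lie_def)
  qed
  have hom: "?\<psi> (x + y) = ?\<psi> x + ?\<psi> y" "?\<psi> (lr_smult ?F a x) = lr_smult E a (?\<psi> x)"
    "?\<psi> (lr_bracket ?F x y) = lr_bracket E (?\<psi> x) (?\<psi> y)"
    "lr_anchor ?F x = lr_anchor E (?\<psi> x)"
    "x + y \<in> lr_carrier ?F" "lr_smult ?F a x \<in> lr_carrier ?F" "lr_bracket ?F x y \<in> lr_carrier ?F"
    if "x \<in> lr_carrier ?F" "y \<in> lr_carrier ?F" for x y a
  proof -
    obtain p l q k where xy: "x = (p, l)" "y = (q, k)" by (cases x, cases y)
    have lk: "l \<in> ?L" "k \<in> ?L"
      using that xy by (auto simp: ext_crossed_product_def span_lie_def)
    show "?\<psi> (x + y) = ?\<psi> x + ?\<psi> y" "?\<psi> (lr_smult ?F a x) = lr_smult E a (?\<psi> x)"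
      "lr_anchor ?F x = lr_anchor E (?\<psi> x)"
      by (simp_all add: xy ext_crossed_product_def span_lie_def algebra_simps D ker lk fun_eq_iff)
    show "x + y \<in> lr_carrier ?F" "lr_smult ?F a x \<in> lr_carrier ?F" "lr_bracket ?F x y \<in> lr_carrier ?F"
      using lk
      by (auto simp: xy ext_crossed_product_def span_lie_def M.span_add M.span_scale M.span_diff Lbr)
    \<comment> \<open>In the expansion of \<open>[p e + l, q e + k]\<close>,
      \<open>[e, e] = 0\<close> and the anchors of \<open>l\<close> and \<open>k\<close> vanish;
      turning \<open>[l, e]\<close> around produces the term \<open>- q [e, l]\<close>.\<close>
    have "lr_bracket E l e = - lr_bracket E e l" by (rule skew)
    then show "?\<psi> (lr_bracket ?F x y) = lr_bracket E (?\<psi> x) (?\<psi> y)"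
      by (simp add: xy ext_crossed_product_def span_lie_def B(2,3,6) D(5,6) brL brR ker lk algebra_simps)
  qed
  have F: "lie_rinehart sA ?F"
  proof (rule lie_rinehart_pullback[OF E _ _ _ _ inj])
    show "0 \<in> lr_carrier ?F"
      by (simp add: ext_crossed_product_def span_lie_def zero_prod_def M.span_zero)
  qed (simp only: UNIV UNIV_I | rule hom; assumption)+
  have "bij_betw ?\<psi> (lr_carrier ?F) (lr_carrier E)"
    unfolding bij_betw_def UNIV using inj surj by simp
  then have "lr_isomorphic sA E ?F"
    by (rule lr_isomorphicI[OF E F]) (rule hom; assumption)+
  with L der show ?thesis
    by (simp add: iso_ext_crossed_product_def a_lie_algebra_def span_lie_def)
qed

section \<open>The crossed product as a Lie Rinehart algebra\<close>

lemma k_algebra_poly: "k_algebra (smult :: 'k::field \<Rightarrow> 'k poly \<Rightarrow> 'k poly)"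
  unfolding k_algebra_def by (auto intro!: vector_space.intro simp: smult_add_right smult_add_left)

context vector_space
begin

text \<open>Pure tensors generate additively by \<open>tensor_decomp\<close>, and zero needs no case
  of its own, being \<open>0 \<otimes> 0\<close>. Identities additive in each argument thus reduce
  to pure tensors.\<close>

lemma tensor_induct [case_names tensor add]:
  assumes tensor: "\<And>a X. P (tensor scale a X)" and add: "\<And>u v. P u \<Longrightarrow> P v \<Longrightarrow> P (u + v)"
  shows "P u"
proof -
  have "P (\<Sum>i\<in>I. tensor scale (monom 1 i) (coeff u i))" for I
  proof (induction I rule: infinite_finite_induct)
    case (insert i I)
    then show ?case using add[OF tensor] by simp
  qed (use tensor[of 0 0] in simp_all)
  then show ?thesis
    by (subst tensor_decomp)
qed

lemma tensor_minus:
  "tensor scale (- a) X = - tensor scale a X" "tensor scale a (- X) = - tensor scale a X"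
  "tensor scale (a - b) X = tensor scale a X - tensor scale b X"
  "tensor scale a (X - Y) = tensor scale a X - tensor scale a Y"
  by (rule poly_eqI, simp add: scale_left_diff_distrib scale_right_diff_distrib)+

lemma module_tens_smult: "module (tens_smult scale)"
proof
  fix a b :: "'a poly" and u v :: "'b poly"
  show "tens_smult scale a (u + v) = tens_smult scale a u + tens_smult scale a v"
    by (rule tens_smult_add)
  show "tens_smult scale (a + b) u = tens_smult scale a u + tens_smult scale b u"
    by (simp add: tens_smult_def distrib_right tensor_add_left sum.distrib)
  show "tens_smult scale a (tens_smult scale b u) = tens_smult scale (a * b) u"
    by (induction u rule: tensor_induct) (simp_all add: tens_smult_tensor tens_smult_add mult.assoc)
  show "tens_smult scale 1 u = u"
    by (induction u rule: tensor_induct) (simp_all add: tens_smult_tensor tens_smult_add)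
qed

end

context lie_algebra
begin

lemmas br_skew = lie_bracket_on_skew[OF lie_bracket UNIV_I UNIV_I UNIV_I]

context
  fixes \<rho> :: "'g \<Rightarrow> 'k poly \<Rightarrow> 'k poly"
  assumes action: "lie_action smult scale br \<rho>"
begin

interpretation M: module "tens_smult scale"
  by (rule module_tens_smult)

lemmas action_add = crossed_anchor_add[OF action] crossed_bracket_add[OF action]
lemmas action_tensor = crossed_anchor_tensor[OF action] crossed_bracket_tensor[OF action]

lemma action_derivation: "\<rho> X \<in> derivations smult"
  using action by (simp add: lie_action_def)

lemma action_bracket: "\<rho> (br X Y) f = \<rho> X (\<rho> Y f) - \<rho> Y (\<rho> X f)"
  using action by (simp add: lie_action_def)

lemma crossed_anchor_smult:
  "crossed_anchor \<rho> (tens_smult scale a u) f = a * crossed_anchor \<rho> u f"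
  by (induction u rule: tensor_induct)
    (simp_all add: tens_smult_tensor tens_smult_add action_add action_tensor algebra_simps)

lemma crossed_anchor_derivation: "crossed_anchor \<rho> u \<in> derivations smult"
proof -
  have vs: "vector_space (smult :: 'k \<Rightarrow> 'k poly \<Rightarrow> 'k poly)"
    using k_algebra_poly by (simp add: k_algebra_def)
  note d = derivationsD[OF action_derivation]
  have "crossed_anchor \<rho> u (f + g) = crossed_anchor \<rho> u f + crossed_anchor \<rho> u g \<and>
      crossed_anchor \<rho> u (smult c f) = smult c (crossed_anchor \<rho> u f) \<and>
      crossed_anchor \<rho> u (f * g) = crossed_anchor \<rho> u f * g + f * crossed_anchor \<rho> u g" for f g c
    by (induction u rule: tensor_induct) (simp_all add: action_add action_tensor d algebra_simps smult_add_right)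
  then show ?thesis
    using vs by (simp add: derivations_def linear_iff_module_hom module_hom_iff module_iff_vector_space)
qed

lemma crossed_bracket_skew: "crossed_bracket scale br \<rho> u v = - crossed_bracket scale br \<rho> v u"
proof (induction u rule: tensor_induct)
  case (tensor a X)
  show ?case
  proof (induction v rule: tensor_induct)
    case (tensor b Y)
    show ?case
      using br_skew[of X Y] by (simp add: action_tensor tensor_minus mult.commute)
  qed (simp add: action_add)
qed (simp add: action_add)

text \<open>The claim is not additive in \<open>u\<close>: the induction leaves cross terms
  \<open>[u, v] + [v, u]\<close>, which skew-symmetry cancels. Skew-symmetry at \<open>v = u\<close>
  alone would not do in characteristic 2.\<close>

lemma crossed_bracket_self: "crossed_bracket scale br \<rho> u u = 0"
proof (induction u rule: tensor_induct)
  case (tensor a X)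
  have "br X X = 0" using lie_bracket by (simp add: lie_bracket_on_def)
  then show ?case by (simp add: action_tensor)
next
  case (add u v)
  then show ?case
    using crossed_bracket_skew[of u v] by (simp add: action_add)
qed

lemma crossed_bracket_leibniz:
  "crossed_bracket scale br \<rho> u (tens_smult scale c v) =
   tens_smult scale c (crossed_bracket scale br \<rho> u v) + tens_smult scale (crossed_anchor \<rho> u c) v"
proof (induction u rule: tensor_induct)
  case (tensor a X)
  show ?case
  proof (induction v rule: tensor_induct)
    case (tensor b Y)
    show ?case
      by (simp add: action_tensor tens_smult_tensor tens_smult_add derivationsD(6)[OF action_derivation]
          M.scale_right_diff_distrib tensor_add_left algebra_simps)
  qed (simp add: action_add tens_smult_add)
qed (simp add: action_add tens_smult_add M.scale_left_distrib)

lemma crossed_anchor_bracket: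
  "crossed_anchor \<rho> (crossed_bracket scale br \<rho> u v) f =
   crossed_anchor \<rho> u (crossed_anchor \<rho> v f) - crossed_anchor \<rho> v (crossed_anchor \<rho> u f)"
proof (induction u rule: tensor_induct)
  case (tensor a X)
  show ?case
  proof (induction v rule: tensor_induct)
    case (tensor b Y)
    have "crossed_anchor \<rho> (x - y) f = crossed_anchor \<rho> x f - crossed_anchor \<rho> y f" for x y
      using crossed_anchor_add[OF action, of "x - y" y f] by (simp add: eq_diff_eq)
    then show ?case
      by (simp add: action_tensor action_add action_bracket derivationsD(6)[OF action_derivation])
        (simp add: algebra_simps)
  qed (simp add: action_add derivationsD(1)[OF crossed_anchor_derivation])
qed (simp add: action_add derivationsD(1)[OF crossed_anchor_derivation])

text \<open>The cyclic sum is additive in each argument, which leaves pure tensors. There the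
  iterated brackets cancel by the Jacobi identity of \<open>\<gg>\<close>, and the remaining terms
  because \<open>\<rho>\<close> is a Lie morphism into derivations.\<close>

lemma crossed_bracket_jacobi:
  "crossed_bracket scale br \<rho> u (crossed_bracket scale br \<rho> v w) +
   crossed_bracket scale br \<rho> v (crossed_bracket scale br \<rho> w u) +
   crossed_bracket scale br \<rho> w (crossed_bracket scale br \<rho> u v) = 0" (is "?J u v w = 0")
proof -
  have add: "?J (u + u') v w = ?J u v w + ?J u' v w" "?J u (v + v') w = ?J u v w + ?J u v' w"
    "?J u v (w + w') = ?J u v w + ?J u v w'" for u u' v v' w w'
    by (simp_all only: action_add) (simp_all add: algebra_simps)
  have diff: "crossed_bracket scale br \<rho> x (y - z) =
      crossed_bracket scale br \<rho> x y - crossed_bracket scale br \<rho> x z" for x y z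
    using crossed_bracket_add(2)[OF action, of x "y - z" z] by simp
  have pure: "?J (tensor scale a X) (tensor scale b Y) (tensor scale c Z) = 0" for a X b Y c Z
  proof -
    have jac: "br X (br Y Z) = - br Y (br Z X) - br Z (br X Y)"
      using lie_bracket_onD(7)[OF lie_bracket, of X Y Z] by (simp add: algebra_simps eq_neg_iff_add_eq_0)
    \<comment> \<open>The skewness instances orient the inner brackets cyclically as
      \<open>br X Y\<close>, \<open>br Y Z\<close>, \<open>br Z X\<close>, so that like terms
      meet.\<close>
    show ?thesis
      using br_skew[of X Z] br_skew[of Y X] br_skew[of Z Y]
      by (simp add: action_tensor action_add diff derivationsD[OF action_derivation] action_bracket
          jac tensor_minus tensor_add_left algebra_simps)
  qed
  show ?thesis
  proof (induction u rule: tensor_induct)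
    case (tensor a X)
    show ?case
    proof (induction v rule: tensor_induct)
      case (tensor b Y)
      show ?case
        by (induction w rule: tensor_induct) (simp_all only: pure add add_0_left)
    qed (simp only: add add_0_left)
  qed (simp only: add add_0_left)
qed

lemma lie_rinehart_crossed_product: "lie_rinehart smult (crossed_product scale br \<rho>)"
proof -
  \<comment> \<open>Scalars act through constant polynomials, which derivations kill, so the Leibniz
    rule gives linearity over \<open>K\<close> in the second argument; skew-symmetry carries it to
    the first.\<close>
  have ks: "crossed_bracket scale br \<rho> u (tens_smult scale (smult c 1) v) =
      tens_smult scale (smult c 1) (crossed_bracket scale br \<rho> u v)" for u v c
    by (simp add: crossed_bracket_leibniz derivationsD(8)[OF crossed_anchor_derivation, simplified])
  have "crossed_bracket scale br \<rho> (tens_smult scale (smult c 1) u) v =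
      tens_smult scale (smult c 1) (crossed_bracket scale br \<rho> u v)" for u v c
    using ks[of v c u] crossed_bracket_skew[of _ v] by simp
  with ks show ?thesis
    by (simp add: lie_rinehart_def k_algebra_poly crossed_product_def module_on_def lie_bracket_on_def
        lr_kscale_def M.scale_right_distrib M.scale_left_distrib fun_eq_iff action_add
        crossed_anchor_smult crossed_anchor_derivation crossed_anchor_bracket crossed_bracket_self
        crossed_bracket_leibniz crossed_bracket_jacobi)
qed

end

end

section \<open>Actions by polynomial vector fields\<close>

lemma linear_functionalD:
  fixes scale :: "'k::field \<Rightarrow> 'b::ab_group_add \<Rightarrow> 'b" and f :: "'b \<Rightarrow> 'k"
  assumes "Vector_Spaces.linear scale (*) f"
  shows "f (x + y) = f x + f y" "f (x - y) = f x - f y" "f (scale c x) = c * f x" "f 0 = 0"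
proof -
  interpret f: Vector_Spaces.linear scale "(*)" f by (rule assms)
  show "f (x + y) = f x + f y" "f (x - y) = f x - f y" "f (scale c x) = c * f x" "f 0 = 0"
    by (simp_all add: f.add f.diff f.scale f.zero)
qed

lemma functional_separation:
  fixes scale :: "'k::field \<Rightarrow> 'b::ab_group_add \<Rightarrow> 'b" and f g :: "'b \<Rightarrow> 'k"
  assumes lin: "Vector_Spaces.linear scale (*) f" "Vector_Spaces.linear scale (*) g"
    and indep: "\<And>c. \<exists>x. f x \<noteq> c * g x"
  obtains x where "f x = 1" "g x = 0"
proof -
  note f = linear_functionalD[OF lin(1)] and g = linear_functionalD[OF lin(2)]
  \<comment> \<open>A point where \<open>g\<close> does not vanish, or any point if
    \<open>g = 0\<close>; in the latter case division by zero gives 0 and \<open>z\<close> below is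
    just \<open>x\<close>.\<close>
  obtain w where w: "g w = 0 \<Longrightarrow> g x = 0" for x by metis
  obtain x where x: "f x \<noteq> f w / g w * g x" using indep by blast
  \<comment> \<open>The projection of \<open>x\<close> to the kernel of \<open>g\<close> along
    \<open>w\<close>; \<open>f z\<close> is nonzero because \<open>x\<close> violates
    \<open>f = (f w / g w) g\<close>.\<close>
  define z where "z = x - scale (g x / g w) w"
  have "g z = 0" using w[of x] by (auto simp: z_def g)
  moreover have "f z \<noteq> 0" using x by (simp add: z_def f mult.commute)
  ultimately show ?thesis
    by (intro that[of "scale (1 / f z) z"]) (simp_all add: f g)
qed

context vector_space
begin

text \<open>The decomposition is \<open>X = (X - f X x) + f X x\<close>. It turns the sums
  \<open>S + span {x0}\<close> and \<open>S + span {y0}\<close> of \<open>adapted\<close> into the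
  kernels of \<open>mu\<close> and \<open>lam\<close>.\<close>

lemma sum_span_eq_kernel:
  assumes f: "Vector_Spaces.linear scale (*) f" "f x = 1" "g x = 0"
    and g: "Vector_Spaces.linear scale (*) g"
  shows "{X. f X = 0 \<and> g X = 0} + span {x} = {X. g X = 0}"
proof (intro equalityI subsetI)
  note fD = linear_functionalD[OF f(1)] and gD = linear_functionalD[OF g]
  fix X
  show "X \<in> {X. g X = 0}" if "X \<in> {X. f X = 0 \<and> g X = 0} + span {x}"
    using that f by (auto simp: set_plus_def span_singleton gD)
  assume "X \<in> {X. g X = 0}"
  then show "X \<in> {X. f X = 0 \<and> g X = 0} + span {x}"
    unfolding set_plus_def span_singleton
    by (intro CollectI bexI[of _ "X - scale (f X) x"] bexI[of _ "scale (f X) x"]) (auto simp: f fD gD)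
qed

end

text \<open>If \<open>m = 0\<close>, coefficients are compared. If \<open>m \<ge> 2\<close>, one
  factor \<open>t + b\<close> is cancelled; the remaining power still vanishes at
  \<open>- b\<close>, so evaluation there isolates \<open>k\<close>.\<close>

lemma power_linear_independent:
  fixes l k b :: "'k::field"
  assumes "m \<noteq> 1" and eq: "smult l ([:b, 1:] ^ m) + smult k [:b, 1:] = 0"
  shows "l = 0 \<and> k = 0"
proof (cases m)
  case 0
  with eq show ?thesis by (auto simp: one_pCons)
next
  case (Suc n)
  with assms(1) obtain n' where n: "n = Suc n'" by (cases n) auto
  have "[:b, 1:] * (smult l ([:b, 1:] ^ n) + [:k:]) = 0"
    using eq by (simp only: Suc power_Suc) (simp add: algebra_simps)
  then have *: "smult l ([:b, 1:] ^ n) + [:k:] = 0"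
    by (metis mult_eq_0_iff one_neq_zero pCons_eq_0_iff)
  then have "poly (smult l ([:b, 1:] ^ n) + [:k:]) (- b) = 0" by simp
  then have "k = 0" by (simp add: n)
  with * show ?thesis by auto
qed

text \<open>With \<open>P = p ^ m\<close> and \<open>p' = 1\<close>, the bracket is
  \<open>(l k' - l' k) (P - p P')\<close>, and Euler's relation gives
  \<open>p P' = m P\<close>.\<close>

lemma pderiv_bracket_power_linear:
  fixes l k l' k' b :: "'k::field"
  defines "p \<equiv> [:b, 1:]"
  shows "(smult l (p ^ m) + smult k p) * pderiv (smult l' (p ^ m) + smult k' p) -
    (smult l' (p ^ m) + smult k' p) * pderiv (smult l (p ^ m) + smult k p) =
    smult ((1 - of_nat m) * (l * k' - l' * k)) (p ^ m)"
proof -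
  \<comment> \<open>The derivative of \<open>P\<close> enters as an independent variable
    \<open>D\<close>, which makes this a pure ring identity.\<close>
  have ring: "(L * P + K * p) * (L' * D + K') - (L' * P + K' * p) * (L * D + K) =
      (L * K' - L' * K) * (P - p * D)" for L L' K K' P D :: "'k poly"
    by (simp add: algebra_simps)
  have p': "pderiv p = 1" by (simp add: p_def pderiv_pCons)
  have d: "pderiv (smult c (p ^ m) + smult c' p) = [:c:] * pderiv (p ^ m) + [:c':]" for c c'
    by (simp add: pderiv_add pderiv_smult p')
  \<comment> \<open>The factor \<open>p\<close> avoids the exponent \<open>m - 1\<close>, which is
    truncated at \<open>m = 0\<close>.\<close>
  have q: "p * pderiv (p ^ m) = smult (of_nat m) (p ^ m)"
  proof (cases m)
    case (Suc n)
    then show ?thesis by (simp only: pderiv_power_Suc p') simp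
  qed simp
  have "(smult l (p ^ m) + smult k p) * pderiv (smult l' (p ^ m) + smult k' p) -
    (smult l' (p ^ m) + smult k' p) * pderiv (smult l (p ^ m) + smult k p) =
    ([:l:] * [:k':] - [:l':] * [:k:]) * (p ^ m - p * pderiv (p ^ m))"
    unfolding d ring[symmetric] by simp
  also have "\<dots> = smult (l * k' - l' * k) (p ^ m - smult (of_nat m) (p ^ m))"
    by (simp add: q mult.commute)
  also have "\<dots> = smult ((1 - of_nat m) * (l * k' - l' * k)) (p ^ m)"
    by (simp add: algebra_simps smult_diff_left smult_diff_right smult_add_left)
  finally show ?thesis .
qed

section \<open>Splitting criterion for crossed products by polynomial vector fields\<close>

context lie_algebra
begin

context
  fixes \<theta> :: "'g \<Rightarrow> 'k poly" and \<rho> :: "'g \<Rightarrow> 'k poly \<Rightarrow> 'k poly"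
  assumes action: "lie_action smult scale br \<rho>" and vf: "\<And>X. \<rho> X = vf (\<theta> X)"
begin

interpretation M: module "tens_smult scale"
  by (rule module_tens_smult)

text \<open>\<open>vf h\<close> sends \<open>t\<close> to \<open>h\<close>, so evaluating the axioms
  of the action at \<open>[:0, 1:]\<close> turns them into identities for
  \<open>\<theta>\<close>.\<close>

lemma action_poly:
  "\<theta> (X + Y) = \<theta> X + \<theta> Y" "\<theta> (scale c X) = smult c (\<theta> X)"
  "\<theta> (br X Y) = \<theta> X * pderiv (\<theta> Y) - \<theta> Y * pderiv (\<theta> X)"
proof -
  have "vf (\<theta> (X + Y)) [:0, 1:] = vf (\<theta> X) [:0, 1:] + vf (\<theta> Y) [:0, 1:]"
    "vf (\<theta> (scale c X)) [:0, 1:] = smult c (vf (\<theta> X) [:0, 1:])"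
    "vf (\<theta> (br X Y)) [:0, 1:] = vf (\<theta> X) (vf (\<theta> Y) [:0, 1:]) - vf (\<theta> Y) (vf (\<theta> X) [:0, 1:])"
    using action[unfolded lie_action_def vf] by (simp_all add: lie_action_def vf)
  then show "\<theta> (X + Y) = \<theta> X + \<theta> Y" "\<theta> (scale c X) = smult c (\<theta> X)"
    "\<theta> (br X Y) = \<theta> X * pderiv (\<theta> Y) - \<theta> Y * pderiv (\<theta> X)"
    by (simp_all add: vf_def pderiv_pCons)
qed

lemma anchor_tensor: "crossed_anchor \<rho> (tensor scale a X) = vf (a * \<theta> X)"
  by (simp add: crossed_anchor_tensor[OF action] vf vf_def fun_eq_iff)

lemma anchor_diff: "crossed_anchor \<rho> u = vf p \<Longrightarrow> crossed_anchor \<rho> v = vf q \<Longrightarrow>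
  crossed_anchor \<rho> (u - v) = vf (p - q)"
  using crossed_anchor_add[OF action, of "u - v" v]
  by (simp add: vf_def fun_eq_iff left_diff_distrib eq_diff_eq)

text \<open>Constant polynomials act as scalars of \<open>K\<close>. Generation over
  \<open>K[t]\<close> may therefore be tested on vectors that span \<open>\<gg>\<close> over
  \<open>K\<close>.\<close>

lemma subspace_tensor_span: "subspace {X. tensor scale 1 X \<in> M.span T}"
proof (rule subspaceI)
  show "scale c X \<in> {X. tensor scale 1 X \<in> M.span T}"
    if "X \<in> {X. tensor scale 1 X \<in> M.span T}" for c X
  proof -
    from that have "tens_smult scale (smult c 1) (tensor scale 1 X) \<in> M.span T"
      by (intro M.span_scale) simp
    then show "scale c X \<in> {X. tensor scale 1 X \<in> M.span T}"
      using tensor_smult[of c 1 X] by (simp add: tens_smult_tensor)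
  qed
qed (simp_all add: M.span_zero M.span_add tensor_add_right)

text \<open>\<open>K[t]\<close> has no zero divisors, so no nonzero \<open>a\<close> annihilates
  \<open>p\<close>; and \<open>a \<otimes> X\<close> is a multiple of \<open>1 \<otimes> X\<close>.
  This supplies the hypotheses of the general splitting.\<close>

lemma iso_ext_crossed_product_generators:
  assumes e: "crossed_anchor \<rho> e = vf p" and "p \<noteq> 0"
    and V: "\<And>v. v \<in> V \<Longrightarrow> crossed_anchor \<rho> v = vf 0"
    and gen: "\<And>X. tensor scale 1 X \<in> M.span (insert e V)"
  defines "E \<equiv> crossed_product scale br \<rho>"
  shows "iso_ext_crossed_product smult E (span_lie E V) (lr_bracket E e) (vf p)"
proof -
  have anchor: "lr_anchor E = crossed_anchor \<rho>" and sm: "lr_smult E = tens_smult scale"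
    by (simp_all add: E_def crossed_product_def)
  have "u \<in> M.span (insert e V)" for u
  proof (induction u rule: tensor_induct)
    case (tensor a X)
    have "tens_smult scale a (tensor scale 1 X) \<in> M.span (insert e V)"
      using gen by (rule M.span_scale)
    then show ?case by (simp add: tens_smult_tensor)
  qed (rule M.span_add)
  then have span: "module.span (lr_smult E) (insert e V) = UNIV"
    by (auto simp: sm)
  have inj: "a = 0" if "\<And>f. a * lr_anchor E e f = 0" for a
    using that[of "[:0, 1:]"] \<open>p \<noteq> 0\<close> by (simp add: anchor e vf_def pderiv_pCons)
  have ker: "lr_anchor E v = (\<lambda>_. 0)" if "v \<in> V" for v
    using V[OF that] by (simp add: anchor vf_def fun_eq_iff)
  have "lie_rinehart smult E" "lr_carrier E = UNIV"
    by (simp_all add: E_def lie_rinehart_crossed_product[OF action]) (simp add: crossed_product_def)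
  from iso_ext_crossed_product_split[OF this ker inj span]
  have "iso_ext_crossed_product smult E (span_lie E V) (lr_bracket E e) (lr_anchor E e)" .
  then show ?thesis by (simp add: anchor e)
qed

text \<open>An element whose anchor has minimal degree generates the image of the anchor.\<close>

lemma crossed_product_splits:
  assumes "\<theta> \<noteq> (\<lambda>_. 0)"
  defines "E \<equiv> crossed_product scale br \<rho>"
  shows "\<exists>(L :: ('k poly, 'g poly) lr_structure) D \<delta>. iso_ext_crossed_product smult E L D \<delta>"
proof -
  \<comment> \<open>Elements are paired with their polynomials, so that the degree can be minimized
    over all nonzero anchors of this form.\<close>
  let ?P = "\<lambda>(u, p). crossed_anchor \<rho> u = vf p \<and> p \<noteq> 0"
  obtain X where "\<theta> X \<noteq> 0" using assms by auto
  then have "?P (tensor scale 1 X, \<theta> X)" by (simp add: anchor_tensor)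
  then obtain ep where "?P ep" and least: "\<And>uq. ?P uq \<Longrightarrow> degree (snd ep) \<le> degree (snd uq)"
    using ex_has_least_nat[of ?P _ "\<lambda>up. degree (snd up)"] by blast
  then obtain e p where e: "crossed_anchor \<rho> e = vf p" and p: "p \<noteq> 0"
    and least: "\<And>u q. crossed_anchor \<rho> u = vf q \<Longrightarrow> q \<noteq> 0 \<Longrightarrow> degree p \<le> degree q"
    by (cases ep) auto
  let ?V = "{v. crossed_anchor \<rho> v = vf 0}"
  have "tensor scale 1 X \<in> M.span (insert e ?V)" for X
  proof -
    \<comment> \<open>Euclidean division: the remainder is the anchor of
      \<open>1 \<otimes> X - q e\<close>, and a nonzero one would have degree below the
      minimum.\<close>
    define q where "q = \<theta> X div p"
    have "crossed_anchor \<rho> (tens_smult scale q e) = vf (q * p)"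
      by (simp add: fun_eq_iff crossed_anchor_smult[OF action] e vf_def mult.assoc)
    then have "crossed_anchor \<rho> (tensor scale 1 X - tens_smult scale q e) = vf (\<theta> X - q * p)"
      by (intro anchor_diff) (simp_all add: anchor_tensor)
    also have "\<theta> X - q * p = \<theta> X mod p"
      by (simp add: q_def minus_div_mult_eq_mod)
    finally have r: "crossed_anchor \<rho> (tensor scale 1 X - tens_smult scale q e) = vf (\<theta> X mod p)" .
    then have "\<theta> X mod p = 0"
      using least[OF r] degree_mod_less[OF p, of "\<theta> X"] by (meson not_le)
    with r have "tensor scale 1 X - tens_smult scale q e \<in> M.span (insert e ?V)"
      by (intro M.span_base) simp
    moreover have "tens_smult scale q e \<in> M.span (insert e ?V)"
      by (intro M.span_scale M.span_base) simp
    ultimately have "tensor scale 1 X - tens_smult scale q e + tens_smult scale q e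
        \<in> M.span (insert e ?V)"
      by (rule M.span_add)
    then show ?thesis by simp
  qed
  from iso_ext_crossed_product_generators[OF e p _ this] show ?thesis
    unfolding E_def by auto
qed

section \<open>Type 1: a single functional\<close>

lemma iso_type1:
  assumes lin: "Vector_Spaces.linear scale (*) lam" and \<theta>: "\<And>X. \<theta> X = smult (lam X) h"
    and "h \<noteq> 0" and x0: "lam x0 = 1"
  defines "E \<equiv> crossed_product scale br \<rho>"
  shows "iso_ext_crossed_product smult E (span_lie E (tensor scale 1 ` {X. lam X = 0}))
    (lr_bracket E (tensor scale 1 x0)) (vf h)"
  unfolding E_def
proof (rule iso_ext_crossed_product_generators[OF _ \<open>h \<noteq> 0\<close>])
  note lam = linear_functionalD[OF lin]
  show "crossed_anchor \<rho> (tensor scale 1 x0) = vf h"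
    by (simp add: anchor_tensor \<theta> x0)
  show "crossed_anchor \<rho> v = vf 0" if "v \<in> tensor scale 1 ` {X. lam X = 0}" for v
    using that by (auto simp: anchor_tensor \<theta>)
  let ?T = "insert (tensor scale 1 x0) (tensor scale 1 ` {X. lam X = 0})"
  let ?U = "{X. tensor scale 1 X \<in> M.span ?T}"
  fix X
  \<comment> \<open>\<open>X\<close> is split along the kernel of \<open>lam\<close> and the line of
    \<open>x0\<close>.\<close>
  have "X - scale (lam X) x0 \<in> ?U"
    by (auto intro!: M.span_base simp: lam x0)
  moreover have "scale (lam X) x0 \<in> ?U"
    by (intro subspace_scale[OF subspace_tensor_span]) (simp add: M.span_base)
  ultimately have "X - scale (lam X) x0 + scale (lam X) x0 \<in> ?U"
    by (rule subspace_add[OF subspace_tensor_span])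
  then show "tensor scale 1 X \<in> M.span ?T" by simp
qed

lemma tensor_span_decomp:
  assumes "\<And>s. s \<in> S \<Longrightarrow> tensor scale 1 s \<in> M.span T"
    and "tensor scale 1 x \<in> M.span T" "tensor scale 1 y \<in> M.span T"
    and "X - scale c x - scale d y \<in> S"
  shows "tensor scale 1 X \<in> M.span T"
proof -
  let ?U = "{X. tensor scale 1 X \<in> M.span T}"
  note sub = subspace_tensor_span[of T]
  have "scale c x \<in> ?U" "scale d y \<in> ?U" "X - scale c x - scale d y \<in> ?U"
    using assms by (auto intro: subspace_scale[OF sub, simplified])
  then have "(X - scale c x - scale d y) + (scale d y + scale c x) \<in> ?U"
    by (intro subspace_add[OF sub])
  then show ?thesis by simp
qed

section \<open>Type 2: two functionals\<close>

context
  fixes lam mu :: "'g \<Rightarrow> 'k" and m :: nat and b :: 'k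
  assumes lin: "Vector_Spaces.linear scale (*) lam" "Vector_Spaces.linear scale (*) mu"
    and type2: "\<And>X. \<theta> X = smult (lam X) ([:b, 1:] ^ m) + smult (mu X) [:b, 1:]"
    and m: "m \<noteq> 1"
begin

text \<open>The coefficients of \<open>(t + b)^m\<close> and \<open>t + b\<close> in
  \<open>\<theta> (br X Y)\<close> are compared. Consequently the common kernel of
  \<open>lam\<close> and \<open>mu\<close> is an ideal, and \<open>mu\<close> kills the derived
  algebra.\<close>

lemma type2_bracket:
  "lam (br X Y) = (1 - of_nat m) * (lam X * mu Y - lam Y * mu X)" "mu (br X Y) = 0"
proof -
  let ?c = "(1 - of_nat m) * (lam X * mu Y - lam Y * mu X)"
  have "smult (lam (br X Y)) ([:b, 1:] ^ m) + smult (mu (br X Y)) [:b, 1:] = smult ?c ([:b, 1:] ^ m)"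
    using action_poly(3)[of X Y] unfolding type2 pderiv_bracket_power_linear .
  then have "smult (lam (br X Y) - ?c) ([:b, 1:] ^ m) + smult (mu (br X Y)) [:b, 1:] = 0"
    by (simp only: smult_diff_left) (simp only: diff_add_eq diff_self)
  from power_linear_independent[OF m this]
  show "lam (br X Y) = ?c" "mu (br X Y) = 0" by auto
qed

lemma adapted_exists:
  assumes indep: "\<And>c d. (\<And>X. c * lam X + d * mu X = 0) \<Longrightarrow> c = 0 \<and> d = 0"
  shows "\<exists>S x0 y0. adapted scale br lam mu m S x0 y0"
proof -
  note l = linear_functionalD[OF lin(1)] and u = linear_functionalD[OF lin(2)]
  \<comment> \<open>Neither functional is a multiple of the other, so separation applies in both
    orders and gives vectors dual to \<open>lam\<close> and \<open>mu\<close>.\<close>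
  have "\<exists>x. lam x \<noteq> c * mu x" "\<exists>x. mu x \<noteq> c * lam x" for c
    using indep[of 1 "- c"] indep[of "- c" 1] by auto
  then obtain x0 y0 where x0: "lam x0 = 1" "mu x0 = 0" and y0: "lam y0 = 0" "mu y0 = 1"
    using functional_separation[OF lin] functional_separation[OF lin(2,1)] by metis
  \<comment> \<open>By \<open>adapted_kernel\<close> below, no other choice of \<open>S\<close> is
    possible.\<close>
  let ?S = "{X. lam X = 0 \<and> mu X = 0}"
  have Sx: "?S + span {x0} = {X. mu X = 0}"
    using sum_span_eq_kernel[OF lin(1) x0 lin(2)] .
  have Sy: "?S + span {y0} = {X. lam X = 0}"
    using sum_span_eq_kernel[OF lin(2) y0(2,1) lin(1)] by (simp add: conj_commute)
  have sub: "subspace ?S" "subspace {X. mu X = 0}"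
    by (auto simp: subspace_def l u)
  have "lie_ideal scale br UNIV ?S"
    by (auto simp: lie_ideal_def sub type2_bracket)
  moreover have "x0 \<noteq> y0" using x0 y0 by auto
  moreover have "independent {x0, y0}"
    using x0 y0 l u by (auto simp: independent_insert span_singleton)
  moreover have "direct_sum scale (?S + span {x0}) ?S (span {x0})"
    unfolding direct_sum_def
  proof (intro conjI sub subspace_span refl)
    show "?S \<inter> span {x0} = {0}"
      using x0 by (auto simp: span_singleton l u)
  qed
  moreover have "direct_sum scale UNIV {X. mu X = 0} (span {y0})"
    unfolding direct_sum_def
  proof (intro conjI sub subspace_span)
    show "{X. mu X = 0} \<inter> span {y0} = {0}"
      using y0 by (auto simp: span_singleton u)
    show "UNIV = {X. mu X = 0} + span {y0}"
    proof (rule UNIV_eq_I)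
      fix X show "X \<in> {X. mu X = 0} + span {y0}"
        unfolding set_plus_def span_singleton
        by (intro CollectI bexI[of _ "X - scale (mu X) y0"] bexI[of _ "scale (mu X) y0"]) (auto simp: u y0)
    qed
  qed
  moreover have "derived_algebra scale br UNIV \<subseteq> {X. mu X = 0}"
    unfolding derived_algebra_def using sub(2) by (intro span_minimal) (auto simp: type2_bracket)
  \<comment> \<open>\<open>lam (br x0 y0)\<close> is \<open>1 - m\<close>, which the term
    \<open>(m - 1) x0\<close> cancels.\<close>
  moreover have "br x0 y0 + scale (of_nat m - 1) x0 \<in> ?S"
    by (simp add: l u type2_bracket x0 y0)
  ultimately have "adapted scale br lam mu m ?S x0 y0"
    using x0 y0 by (simp add: adapted_def Let_def Sx Sy)
  then show ?thesis by blast
qed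

context
  fixes S x0 y0
  assumes adapted: "adapted scale br lam mu m S x0 y0"
begin

text \<open>\<open>adapted\<close> states the vanishing only on sums of subspaces; \<open>S\<close>,
  \<open>x0\<close> and \<open>y0\<close> lie in these sums since 0 is in every summand. For the
  converse inclusion, \<open>X = s + c x0 + d y0\<close> has \<open>lam X = c\<close> and
  \<open>mu X = d\<close>.\<close>

lemma adapted_values: "lam x0 = 1" "mu y0 = 1" "mu x0 = 0" "lam y0 = 0"
  and adapted_kernel: "S = {X. lam X = 0} \<inter> {X. mu X = 0}"
proof -
  note l = linear_functionalD[OF lin(1)] and u = linear_functionalD[OF lin(2)]
  have dec: "UNIV = S + span {x0} + span {y0}" and S0: "0 \<in> S"
    and l0: "\<And>X. X \<in> S + span {y0} \<Longrightarrow> lam X = 0" and u0: "\<And>X. X \<in> S + span {x0} \<Longrightarrow> mu X = 0"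
    and v: "lam x0 = 1" "mu y0 = 1"
    using adapted subspace_0 by (auto simp: adapted_def Let_def direct_sum_def lie_ideal_def)
  have "0 + x0 \<in> S + span {x0}" "0 + y0 \<in> S + span {y0}"
    by (intro set_plus_intro S0 span_base; simp)+
  with l0 u0 show v': "mu x0 = 0" "lam y0 = 0" by auto
  show "lam x0 = 1" "mu y0 = 1" by (fact v)+
  have S: "lam s = 0" "mu s = 0" if "s \<in> S" for s
  proof -
    have "s + 0 \<in> S + span {y0}" "s + 0 \<in> S + span {x0}"
      using that by (auto intro!: set_plus_intro span_zero simp del: add_0_right)
    with l0 u0 show "lam s = 0" "mu s = 0" by auto
  qed
  show "S = {X. lam X = 0} \<inter> {X. mu X = 0}"
  proof (intro equalityI subsetI)
    fix X assume X: "X \<in> {X. lam X = 0} \<inter> {X. mu X = 0}"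
    have "X \<in> S + span {x0} + span {y0}" using dec by blast
    then obtain s c d where s: "s \<in> S" "X = s + scale c x0 + scale d y0"
      by (auto simp: set_plus_def span_singleton)
    with X have "c = 0" "d = 0" by (auto simp: l u S v v')
    with s show "X \<in> S" by simp
  qed (use S in auto)
qed

lemma adapted_decomp: "X - scale (lam X) x0 - scale (mu X) y0 \<in> S"
  by (simp add: adapted_kernel linear_functionalD[OF lin(1)] linear_functionalD[OF lin(2)] adapted_values)

text \<open>The anchors of \<open>x0\<close> and \<open>y0\<close> are \<open>(t + b)^m\<close> and
  \<open>t + b\<close>, so \<open>(t + b)^(m - 1) y0\<close> cancels the anchor of
  \<open>x0\<close>. As \<open>m \<noteq> 0\<close>, the exponent is not truncated.\<close>

lemma iso_type2:
  defines "E \<equiv> crossed_product scale br \<rho>"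
  assumes "m \<noteq> 0"
  shows "iso_ext_crossed_product smult E
    (span_lie E (tensor scale 1 ` S \<union> {tensor scale 1 x0 - tensor scale ([:b, 1:] ^ (m - 1)) y0}))
    (lr_bracket E (tensor scale 1 y0)) (vf [:b, 1:])"
  unfolding E_def
proof (rule iso_ext_crossed_product_generators)
  let ?V = "tensor scale 1 ` S \<union> {tensor scale 1 x0 - tensor scale ([:b, 1:] ^ (m - 1)) y0}"
  let ?T = "insert (tensor scale 1 y0) ?V"
  have "crossed_anchor \<rho> (tensor scale ([:b, 1:] ^ (m - 1)) y0) = vf ([:b, 1:] ^ (m - 1) * [:b, 1:])"
    by (simp only: anchor_tensor type2 adapted_values smult_0_left smult_1_left add_0_left)
  also have "[:b, 1:] ^ (m - 1) * [:b, 1:] = [:b, 1:] ^ m"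
    using \<open>m \<noteq> 0\<close> by (intro power_minus_mult) simp
  finally have w: "crossed_anchor \<rho> (tensor scale 1 x0 - tensor scale ([:b, 1:] ^ (m - 1)) y0) =
      vf ([:b, 1:] ^ m - [:b, 1:] ^ m)"
    by (rule anchor_diff[rotated]) (simp add: anchor_tensor type2 adapted_values)
  show "crossed_anchor \<rho> (tensor scale 1 y0) = vf [:b, 1:]"
    by (simp add: anchor_tensor type2 adapted_values)
  show "[:b, 1:] \<noteq> 0" by simp
  show "crossed_anchor \<rho> v = vf 0" if "v \<in> ?V" for v
    using that w by (auto simp: anchor_tensor type2 adapted_kernel)
  have y: "tensor scale 1 y0 \<in> M.span ?T"
    by (simp add: M.span_base)
  \<comment> \<open>\<open>x0\<close> is recovered as the anchor-free generator plus a multiple of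
    \<open>y0\<close>.\<close>
  have "tens_smult scale ([:b, 1:] ^ (m - 1)) (tensor scale 1 y0) \<in> M.span ?T"
    using y by (rule M.span_scale)
  moreover have "tensor scale 1 x0 - tensor scale ([:b, 1:] ^ (m - 1)) y0 \<in> M.span ?T"
    by (simp add: M.span_base)
  ultimately have "tens_smult scale ([:b, 1:] ^ (m - 1)) (tensor scale 1 y0) +
      (tensor scale 1 x0 - tensor scale ([:b, 1:] ^ (m - 1)) y0) \<in> M.span ?T"
    by (rule M.span_add)
  then have x: "tensor scale 1 x0 \<in> M.span ?T"
    by (simp add: tens_smult_tensor)
  show "tensor scale 1 X \<in> M.span ?T" for X
    by (rule tensor_span_decomp[OF _ x y adapted_decomp]) (simp add: M.span_base)
qed

text \<open>Here \<open>x0\<close> has anchor 1 and \<open>y0\<close> has anchor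
  \<open>t + b\<close>. So \<open>x0\<close> is split off, and \<open>(t + b) x0\<close> cancels the
  anchor of \<open>y0\<close>.\<close>

lemma iso_type2_zero:
  defines "E \<equiv> crossed_product scale br \<rho>"
  assumes "m = 0"
  shows "iso_ext_crossed_product smult E
    (span_lie E (tensor scale 1 ` S \<union> {tensor scale [:b, 1:] x0 - tensor scale 1 y0}))
    (lr_bracket E (tensor scale 1 x0)) (vf 1)"
  unfolding E_def
proof (rule iso_ext_crossed_product_generators)
  let ?V = "tensor scale 1 ` S \<union> {tensor scale [:b, 1:] x0 - tensor scale 1 y0}"
  let ?T = "insert (tensor scale 1 x0) ?V"
  have w: "crossed_anchor \<rho> (tensor scale [:b, 1:] x0 - tensor scale 1 y0) = vf ([:b, 1:] - [:b, 1:])"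
    by (intro anchor_diff) (simp_all add: anchor_tensor type2 adapted_values \<open>m = 0\<close>)
  show "crossed_anchor \<rho> (tensor scale 1 x0) = vf 1"
    by (simp add: anchor_tensor type2 adapted_values \<open>m = 0\<close> one_pCons)
  show "(1 :: 'k poly) \<noteq> 0" by simp
  show "crossed_anchor \<rho> v = vf 0" if "v \<in> ?V" for v
    using that w by (auto simp: anchor_tensor type2 adapted_kernel)
  have x: "tensor scale 1 x0 \<in> M.span ?T"
    by (simp add: M.span_base)
  have "tens_smult scale [:b, 1:] (tensor scale 1 x0) \<in> M.span ?T"
    using x by (rule M.span_scale)
  moreover have "tensor scale [:b, 1:] x0 - tensor scale 1 y0 \<in> M.span ?T"
    by (simp add: M.span_base)
  ultimately have "tens_smult scale [:b, 1:] (tensor scale 1 x0) -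
      (tensor scale [:b, 1:] x0 - tensor scale 1 y0) \<in> M.span ?T"
    by (rule M.span_diff)
  then have y: "tensor scale 1 y0 \<in> M.span ?T"
    by (simp add: tens_smult_tensor)
  show "tensor scale 1 X \<in> M.span ?T" for X
    by (rule tensor_span_decomp[OF _ x y adapted_decomp]) (simp add: M.span_base)
qed

end

end

section \<open>Type 3: a copy of \<open>sl(2)\<close>\<close>

lemma iso_type3:
  assumes type3: "action_type3 scale br \<theta> M \<ss> M0 X0 X1 X2"
  defines "E \<equiv> crossed_product scale br \<rho>"
  shows "iso_ext_crossed_product smult E
    (span_lie E (tensor scale 1 ` lie_radical scale br \<union> tensor scale 1 ` M0 \<union>
       {tensor scale 1 X2 - tensor scale [:0, 1:] X1, tensor scale 1 X1 - tensor scale [:0, 1:] X0}))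
    (lr_bracket E (tensor scale 1 X0)) (vf 1)"
  unfolding E_def
proof (rule iso_ext_crossed_product_generators)
  let ?w1 = "tensor scale 1 X1 - tensor scale [:0, 1:] X0"
    and ?w2 = "tensor scale 1 X2 - tensor scale [:0, 1:] X1"
  let ?R = "lie_radical scale br"
  let ?V = "tensor scale 1 ` ?R \<union> tensor scale 1 ` M0 \<union> {?w2, ?w1}"
  let ?T = "insert (tensor scale 1 X0) ?V"
  \<comment> \<open>The decompositions of \<open>\<gg>\<close> and of \<open>M\<close> combine to
    \<open>\<gg> = Rad \<gg> + span {X0, X1, X2} + M0\<close>, whose outer summands lie in the
    kernel of \<open>\<theta>\<close>.\<close>
  have \<theta>: "\<theta> X0 = 1" "\<theta> X1 = [:0, 1:]" "\<theta> X2 = [:0, 1:] ^ 2"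
    and ker: "{X. \<theta> X = 0} = ?R + M0" and sub: "subspace ?R" "subspace M0"
    and g: "UNIV = ?R + M" and M: "M = span {X0, X1, X2} + M0"
    using type3
    by (auto simp: action_type3_def levi_subalgebra_def semidirect_sum_def lie_direct_sum_def direct_sum_def)
  have "X + 0 \<in> ?R + M0" if "X \<in> ?R" for X
    using that subspace_0[OF sub(2)] by (rule set_plus_intro)
  moreover have "0 + X \<in> ?R + M0" if "X \<in> M0" for X
    using subspace_0[OF sub(1)] that by (rule set_plus_intro)
  ultimately have ker0: "\<theta> X = 0" if "X \<in> ?R \<or> X \<in> M0" for X
    using that ker by auto
  have w1: "crossed_anchor \<rho> ?w1 = vf ([:0, 1:] - [:0, 1:])"
    by (intro anchor_diff) (simp_all add: anchor_tensor \<theta>)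
  have w2: "crossed_anchor \<rho> ?w2 = vf ([:0, 1:] ^ 2 - [:0, 1:] ^ 2)"
    by (intro anchor_diff) (simp_all add: anchor_tensor \<theta> power2_eq_square)
  show "crossed_anchor \<rho> (tensor scale 1 X0) = vf 1"
    by (simp add: anchor_tensor \<theta>)
  show "(1 :: 'k poly) \<noteq> 0" by simp
  show "crossed_anchor \<rho> v = vf 0" if "v \<in> ?V" for v
    using that w1 w2 by (auto simp: anchor_tensor ker0)
  \<comment> \<open>One rung of a ladder: from \<open>X\<close> and the generator
    \<open>Y - t X\<close> one reaches \<open>Y\<close>. Starting at \<open>X0\<close>, it yields
    \<open>X1\<close> and then \<open>X2\<close>.\<close>
  have x: "tensor scale 1 Y \<in> M.span ?T"
    if "tensor scale 1 Y - tensor scale [:0, 1:] X \<in> ?T" "tensor scale 1 X \<in> M.span ?T" for X Y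
  proof -
    have "tensor scale 1 Y - tensor scale [:0, 1:] X + tens_smult scale [:0, 1:] (tensor scale 1 X) \<in> M.span ?T"
      by (intro M.span_add M.span_scale M.span_base that)
    then show ?thesis by (simp add: tens_smult_tensor)
  qed
  have x0: "tensor scale 1 X0 \<in> M.span ?T" by (simp add: M.span_base)
  have x1: "tensor scale 1 X1 \<in> M.span ?T" by (rule x[OF _ x0]) simp
  have x2: "tensor scale 1 X2 \<in> M.span ?T" by (rule x[OF _ x1]) simp
  let ?U = "{X. tensor scale 1 X \<in> M.span ?T}"
  have s: "span {X0, X1, X2} \<subseteq> ?U"
    using x0 x1 x2 by (intro span_minimal subspace_tensor_span) auto
  have RM0: "?R \<subseteq> ?U" "M0 \<subseteq> ?U"
    by (auto intro: M.span_base)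
  fix X
  have "X \<in> ?R + (span {X0, X1, X2} + M0)" using g M by blast
  then obtain r s' m0 where X: "X = r + (s' + m0)" "r \<in> ?R" "s' \<in> span {X0, X1, X2}" "m0 \<in> M0"
    by (auto simp: set_plus_def)
  have "r + (s' + m0) \<in> ?U"
    using X s RM0 by (intro subspace_add[OF subspace_tensor_span]) blast+
  then show "tensor scale 1 X \<in> M.span ?T" by (simp add: X)
qed

end

end

section \<open>Assembly of the general splitting and the three types\<close>

theorem theorem2p4:
  fixes scale :: "'k::real_normed_field \<Rightarrow> 'g::ab_group_add \<Rightarrow> 'g"
    and br :: "'g \<Rightarrow> 'g \<Rightarrow> 'g"
    and \<theta> :: "'g \<Rightarrow> 'k poly"
  assumes "fin_dim_lie_algebra scale br"
    and "lie_action smult scale br (\<lambda>X. vf (\<theta> X))"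
    and "\<theta> \<noteq> (\<lambda>_. 0)"
  shows "let E = crossed_product scale br (\<lambda>X. vf (\<theta> X));
             \<iota> = tensor scale 1
         in
      (\<exists>(L :: ('k poly, 'g poly) lr_structure) D \<delta>. iso_ext_crossed_product smult E L D \<delta>)
    \<and> (\<forall>M lam h. action_type1 scale br \<theta> M lam h \<longrightarrow>
         (\<exists>x0. lam x0 = 1) \<and>
         (\<forall>x0. lam x0 = 1 \<longrightarrow>
            iso_ext_crossed_product smult E
              (span_lie E (\<iota> ` {X. lam X = 0})) (lr_bracket E (\<iota> x0)) (vf h)))
    \<and> (\<forall>M lam mu m b. action_type2 scale br \<theta> M lam mu m b \<longrightarrow>
         (\<exists>S x0 y0. adapted scale br lam mu m S x0 y0) \<and>
         (\<forall>S x0 y0. adapted scale br lam mu m S x0 y0 \<longrightarrow>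
            S = {X. lam X = 0} \<inter> {X. mu X = 0} \<and>
            (m \<noteq> 0 \<longrightarrow>
               iso_ext_crossed_product smult E
                 (span_lie E (\<iota> ` S \<union> {\<iota> x0 - tensor scale ([:b, 1:] ^ (m - 1)) y0}))
                 (lr_bracket E (\<iota> y0)) (vf [:b, 1:])) \<and>
            (m = 0 \<longrightarrow>
               iso_ext_crossed_product smult E
                 (span_lie E (\<iota> ` S \<union> {tensor scale [:b, 1:] x0 - \<iota> y0}))
                 (lr_bracket E (\<iota> x0)) (vf 1))))
    \<and> (\<forall>M \<ss> M0 X0 X1 X2. action_type3 scale br \<theta> M \<ss> M0 X0 X1 X2 \<longrightarrow>
         iso_ext_crossed_product smult E
           (span_lie E (\<iota> ` lie_radical scale br \<union> \<iota> ` M0 \<union>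
              {\<iota> X2 - tensor scale [:0, 1:] X1, \<iota> X1 - tensor scale [:0, 1:] X0}))
           (lr_bracket E (\<iota> X0)) (vf 1))"
proof -
  interpret fin_dim_lie_algebra scale br by (rule assms(1))
  note action = assms(2)
  let ?E = "crossed_product scale br (\<lambda>X. vf (\<theta> X))"
  have exists: "\<exists>x0. lam x0 = 1" if "Vector_Spaces.linear scale (*) lam" "lam \<noteq> (\<lambda>_. 0)" for lam :: "'g \<Rightarrow> 'k"
  proof -
    from that(2) obtain x where "lam x \<noteq> 0" by auto
    then have "lam (scale (1 / lam x) x) = 1"
      by (simp add: linear_functionalD[OF that(1)])
    then show ?thesis by blast
  qed
  show ?thesis
    unfolding Let_def
  proof (intro conjI allI impI)
    \<comment> \<open>The minimal degree argument covers every nonzero \<open>\<theta>\<close>,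
      whatever its type. Here and below \<open>refl\<close> identifies \<open>\<rho> X\<close> with
      \<open>vf (\<theta> X)\<close>.\<close>
    show "\<exists>(L :: ('k poly, 'g poly) lr_structure) D \<delta>.
        iso_ext_crossed_product smult (crossed_product scale br (\<lambda>X. vf (\<theta> X))) L D \<delta>"
      by (rule crossed_product_splits[OF action refl assms(3)])
  next
    fix M lam h
    assume "action_type1 scale br \<theta> M lam h"
    then have lin: "Vector_Spaces.linear scale (*) lam" "lam \<noteq> (\<lambda>_. 0)"
      and h: "h \<noteq> 0" and \<theta>: "\<And>X. \<theta> X = smult (lam X) h"
      by (auto simp: action_type1_def)
    show "\<exists>x0. lam x0 = 1" by (rule exists[OF lin])
    show "iso_ext_crossed_product smult ?E (span_lie ?E (tensor scale 1 ` {X. lam X = 0}))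
        (lr_bracket ?E (tensor scale 1 x0)) (vf h)" if "lam x0 = 1" for x0
      by (rule iso_type1[OF action refl lin(1) \<theta> h that])
  next
    fix M lam mu m b
    assume "action_type2 scale br \<theta> M lam mu m b"
    then have type2: "Vector_Spaces.linear scale (*) lam" "Vector_Spaces.linear scale (*) mu"
      "\<And>X. \<theta> X = smult (lam X) ([:b, 1:] ^ m) + smult (mu X) [:b, 1:]" "m \<noteq> 1"
      and indep: "\<And>c d. (\<And>X. c * lam X + d * mu X = 0) \<Longrightarrow> c = 0 \<and> d = 0"
      unfolding action_type2_def by blast+
    note assms2 = action refl type2
    show "\<exists>S x0 y0. adapted scale br lam mu m S x0 y0"
      by (rule adapted_exists[OF assms2 indep])
    fix S x0 y0
    assume adapted: "adapted scale br lam mu m S x0 y0"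
    show "S = {X. lam X = 0} \<inter> {X. mu X = 0}"
      by (rule adapted_kernel[OF assms2 adapted])
    show "iso_ext_crossed_product smult ?E
        (span_lie ?E (tensor scale 1 ` S \<union> {tensor scale 1 x0 - tensor scale ([:b, 1:] ^ (m - 1)) y0}))
        (lr_bracket ?E (tensor scale 1 y0)) (vf [:b, 1:])" if "m \<noteq> 0"
      by (rule iso_type2[OF assms2 adapted that])
    show "iso_ext_crossed_product smult ?E
        (span_lie ?E (tensor scale 1 ` S \<union> {tensor scale [:b, 1:] x0 - tensor scale 1 y0}))
        (lr_bracket ?E (tensor scale 1 x0)) (vf 1)" if "m = 0"
      by (rule iso_type2_zero[OF assms2 adapted that])
  next
    fix M \<ss> M0 X0 X1 X2
    assume "action_type3 scale br \<theta> M \<ss> M0 X0 X1 X2"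
    then show "iso_ext_crossed_product smult ?E
        (span_lie ?E (tensor scale 1 ` lie_radical scale br \<union> tensor scale 1 ` M0 \<union>
           {tensor scale 1 X2 - tensor scale [:0, 1:] X1, tensor scale 1 X1 - tensor scale [:0, 1:] X0}))
        (lr_bracket ?E (tensor scale 1 X0)) (vf 1)"
      by (rule iso_type3[OF action refl])
  qed
qed

end
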